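(* Let $\Gamma=(V,E)$ be an unbalanced distance-biregular graph with diameter $d=2r+2$ and girth deficiency two, and let $\mathcal A_d(k,l)$ be its adjacency algebra. Up to isomorphism, $\mathcal A_d(k,l)$ has exactly $r+3$ finite-dimensional irreducible representations. These are the three 1-dimensional representations $U_{1,1},U_{1,2},U_{1,3}$ and the 2-dimensional representations $U_{t_1},\ldots,U_{t_r}$ corresponding to the roots $t_1,\ldots,t_r$ of the polynomial $F_r(X)$.
   Context: All graphs are finite, undirected and simple. For a connected graph $\Gamma$ and a vertex $u$, $\Gamma_i(u)$ is the set of vertices at distance $i$ from $u$, and $\varepsilon(u)$ is the eccentricity of $u$. A connected bipartite graph with bipartition classes $A$, $B$ is distance-biregular if, for every vertex $u$, every $0\le i\le\varepsilon(u)$ and every $v\in\Gamma_i(u)$, the numbers $|\Gamma_{i+1}(u)\cap\Gamma_1(v)|$ and $|\Gamma_{i-1}(u)\cap\Gamma_1(v)|$ depend only on $i$ and on the class containing $u$. All vertices of $A$ (resp. $B$) then have the same eccentricity $d_A$ (resp. $d_B$). The graph is unbalanced if $d_A\ne d_B$; it has girth deficiency two if its girth is $2d-2$, where $d$ is the diameter. In the unbalanced case the classes are labelled so that $d=d_A>d_B$; it is known that then $d$ is even, and we write $d=2r+2$ ($r\ge1$). The degree of the vertices of $A$ is $k+1$ and the degree of the vertices of $B$ is $l+1$. Let $M,N$ be the $\{0,1\}$-matrices indexed by $E\times E$ with $M_{e,f}=1$ iff $e\neq f$ and $e,f$ share their vertex in $A$, and $N_{e,f}=1$ iff $e\ne f$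 and $e,f$ share their vertex in $B$. The adjacency algebra $\mathcal A_d(k,l)$ is the subalgebra of $\mathrm{Mat}_E(\mathbb C)$ generated by $I,M,N$. A representation is a complex vector space $U$ with a unital algebra homomorphism $\rho:\mathcal A_d(k,l)\to\mathrm{End}(U)$. The 1-dimensional representations are determined by: $U_{1,1}$: $M\mapsto k$, $N\mapsto l$; $U_{1,2}$: $M\mapsto -1$, $N\mapsto -1$; $U_{1,3}$: $M\mapsto k$, $N\mapsto -1$. The polynomials $F_i(X)\in\mathbb Z[X]$ are defined by $F_0(X)=1$, $F_1(X)=X+k$, $F_{i+2}(X)=XF_{i+1}(X)-kl\,F_i(X)$ for $i\ge0$. For a root $t$ of $F_r(X)$, $U_t=\mathbb C^2$ is the representation with $\rho_t(M)=\begin{pmatrix} k & 0 \\ 0 & -1 \end{pmatrix}$ and $\rho_t(N)=\begin{pmatrix} x & z \\ z & y \end{pmatrix}$, where $x=\frac{t+l-1}{k+1}$, $y=\frac{kl-k-t}{k+1}$ and $z$ is a fixed complex number with $z^2=\frac{(1+kl-t)(t+k+l)}{(k+1)^2}$. *)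

theory Defs
  imports
    "HOL-Analysis.Cartesian_Space"
    "HOL-Analysis.Determinants"
    "HOL-Computational_Algebra.Polynomial"
    "HOL-Library.Extended_Nat"
begin

subsection \<open>Graphs\<close>

definition simple_graph :: "'v set \<Rightarrow> 'v set set \<Rightarrow> bool" where
  "simple_graph V E \<longleftrightarrow> finite V \<and> (\<forall>e\<in>E. e \<subseteq> V \<and> card e = 2)"

definition adj_rel :: "'v set set \<Rightarrow> ('v \<times> 'v) set" where
  "adj_rel E = {(u, v). u \<noteq> v \<and> {u, v} \<in> E}"

definition connected_graph :: "'v set \<Rightarrow> 'v set set \<Rightarrow> bool" where
  "connected_graph V E \<longleftrightarrow>
     simple_graph V E \<and> V \<noteq> {} \<and> (\<forall>u\<in>V. \<forall>v\<in>V. (u, v) \<in> (adj_rel E)\<^sup>*)"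

text \<open>The distance is only meaningful for vertices joined by a walk, hence for all
  pairs of vertices of a connected graph.\<close>

definition gdist :: "'v set set \<Rightarrow> 'v \<Rightarrow> 'v \<Rightarrow> nat" where
  "gdist E u v = (LEAST n. (u, v) \<in> adj_rel E ^^ n)"

definition sphere_at :: "'v set \<Rightarrow> 'v set set \<Rightarrow> nat \<Rightarrow> 'v \<Rightarrow> 'v set" where
  "sphere_at V E i u = {v \<in> V. gdist E u v = i}"

definition eccentricity :: "'v set \<Rightarrow> 'v set set \<Rightarrow> 'v \<Rightarrow> nat" where
  "eccentricity V E u = Max (gdist E u ` V)"

definition diameter :: "'v set \<Rightarrow> 'v set set \<Rightarrow> nat" where
  "diameter V E = Max (eccentricity V E ` V)"

definition degree_of :: "'v set set \<Rightarrow> 'v \<Rightarrow> nat" where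
  "degree_of E v = card {e \<in> E. v \<in> e}"

text \<open>A cycle is given by its cyclic sequence of pairwise distinct vertices, so its length
  is the length of the list.\<close>

definition is_cycle :: "'v set set \<Rightarrow> 'v list \<Rightarrow> bool" where
  "is_cycle E c \<longleftrightarrow> 3 \<le> length c \<and> distinct c \<and>
     (\<forall>i < length c. {c ! i, c ! (Suc i mod length c)} \<in> E)"

text \<open>The girth of a forest is \<open>\<infinity>\<close>.\<close>

definition girth :: "'v set set \<Rightarrow> enat" where
  "girth E = (INF c\<in>{c. is_cycle E c}. enat (length c))"

definition bipartition :: "'v set \<Rightarrow> 'v set set \<Rightarrow> 'v set \<Rightarrow> 'v set \<Rightarrow> bool" where
  "bipartition V E A B \<longleftrightarrow> A \<union> B = V \<and> A \<inter> B = {} \<and>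
     (\<forall>e\<in>E. \<exists>a\<in>A. \<exists>b\<in>B. e = {a, b})"

text \<open>The functions \<open>b\<close> and \<open>c\<close> below may differ for the two classes. For \<open>i = 0\<close>
  the second number is the size of a subset of the empty set \<open>\<Gamma>\<^sub>-\<^sub>1(u)\<close>, so no
  condition arises.\<close>

definition distance_biregular :: "'v set \<Rightarrow> 'v set set \<Rightarrow> 'v set \<Rightarrow> 'v set \<Rightarrow> bool" where
  "distance_biregular V E A B \<longleftrightarrow> connected_graph V E \<and> bipartition V E A B \<and>
     (\<forall>C\<in>{A, B}. \<exists>b c :: nat \<Rightarrow> nat. \<forall>u\<in>C. \<forall>i \<le> eccentricity V E u. \<forall>v\<in>sphere_at V E i u.
        card (sphere_at V E (Suc i) u \<inter> sphere_at V E 1 v) = b i \<and>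
        (i > 0 \<longrightarrow> card (sphere_at V E (i - 1) u \<inter> sphere_at V E 1 v) = c i))"

subsection \<open>The adjacency algebra\<close>

text \<open>Elements of \<open>Mat\<^sub>E(\<complex>)\<close> are functions of two edges that vanish outside \<open>E \<times> E\<close>;
  all matrices constructed below have this property.\<close>

type_synonym 'e cmat = "'e \<Rightarrow> 'e \<Rightarrow> complex"

definition cmat_one :: "'e set \<Rightarrow> 'e cmat" where
  "cmat_one E = (\<lambda>e f. if e \<in> E \<and> e = f then 1 else 0)"

definition cmat_add :: "'e cmat \<Rightarrow> 'e cmat \<Rightarrow> 'e cmat" where
  "cmat_add a b = (\<lambda>e f. a e f + b e f)"

definition cmat_smult :: "complex \<Rightarrow> 'e cmat \<Rightarrow> 'e cmat" where
  "cmat_smult c a = (\<lambda>e f. c * a e f)"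

definition cmat_mult :: "'e set \<Rightarrow> 'e cmat \<Rightarrow> 'e cmat \<Rightarrow> 'e cmat" where
  "cmat_mult E a b = (\<lambda>e f. \<Sum>g\<in>E. a e g * b g f)"

inductive_set generated_algebra :: "'e set \<Rightarrow> 'e cmat set \<Rightarrow> 'e cmat set"
  for E :: "'e set" and S :: "'e cmat set" where
  one: "cmat_one E \<in> generated_algebra E S"
| gen: "a \<in> S \<Longrightarrow> a \<in> generated_algebra E S"
| add: "a \<in> generated_algebra E S \<Longrightarrow> b \<in> generated_algebra E S \<Longrightarrow>
    cmat_add a b \<in> generated_algebra E S"
| smult: "a \<in> generated_algebra E S \<Longrightarrow> cmat_smult c a \<in> generated_algebra E S"
| mult: "a \<in> generated_algebra E S \<Longrightarrow> b \<in> generated_algebra E S \<Longrightarrow>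
    cmat_mult E a b \<in> generated_algebra E S"

text \<open>For a bipartition class \<open>C\<close>, every edge meets \<open>C\<close> in exactly one vertex, so
  \<open>e \<inter> C = f \<inter> C\<close> says that \<open>e\<close> and \<open>f\<close> share their vertex in \<open>C\<close>. The matrices
  \<open>M\<close> and \<open>N\<close> are obtained for \<open>C = A\<close> and \<open>C = B\<close>.\<close>

definition share_matrix :: "'v set set \<Rightarrow> 'v set \<Rightarrow> 'v set cmat" where
  "share_matrix E C = (\<lambda>e f. if e \<in> E \<and> f \<in> E \<and> e \<noteq> f \<and> e \<inter> C = f \<inter> C then 1 else 0)"

definition adjacency_algebra :: "'v set set \<Rightarrow> 'v set \<Rightarrow> 'v set \<Rightarrow> 'v set cmat set" where
  "adjacency_algebra E A B = generated_algebra E {share_matrix E A, share_matrix E B}"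

subsection \<open>Representations\<close>

text \<open>The vector space is the type \<open>'u\<close> with scalar multiplication \<open>s\<close>. The map \<open>\<rho>\<close> is a
  total function of which only the values on the algebra \<open>\<A>\<close> (a set of matrices indexed by
  \<open>E\<close>) are relevant.\<close>

definition representation ::
  "'e set \<Rightarrow> 'e cmat set \<Rightarrow> (complex \<Rightarrow> 'u \<Rightarrow> 'u::ab_group_add) \<Rightarrow> ('e cmat \<Rightarrow> 'u \<Rightarrow> 'u) \<Rightarrow> bool"
  where
  "representation E \<A> s \<rho> \<longleftrightarrow>
     vector_space s \<and>
     (\<forall>a\<in>\<A>. Vector_Spaces.linear s s (\<rho> a)) \<and>
     \<rho> (cmat_one E) = id \<and>
     (\<forall>a\<in>\<A>. \<forall>b\<in>\<A>. \<rho> (cmat_add a b) = (\<lambda>u. \<rho> a u + \<rho> b u)) \<and>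
     (\<forall>c. \<forall>a\<in>\<A>. \<rho> (cmat_smult c a) = (\<lambda>u. s c (\<rho> a u))) \<and>
     (\<forall>a\<in>\<A>. \<forall>b\<in>\<A>. \<rho> (cmat_mult E a b) = \<rho> a \<circ> \<rho> b)"

definition irreducible_rep ::
  "'e set \<Rightarrow> 'e cmat set \<Rightarrow> (complex \<Rightarrow> 'u \<Rightarrow> 'u::ab_group_add) \<Rightarrow> ('e cmat \<Rightarrow> 'u \<Rightarrow> 'u) \<Rightarrow> bool"
  where
  "irreducible_rep E \<A> s \<rho> \<longleftrightarrow>
     representation E \<A> s \<rho> \<and> (UNIV :: 'u set) \<noteq> {0} \<and>
     (\<forall>W. module.subspace s W \<and> (\<forall>a\<in>\<A>. \<rho> a ` W \<subseteq> W) \<longrightarrow> W = {0} \<or> W = UNIV)"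

definition finite_dim :: "(complex \<Rightarrow> 'u \<Rightarrow> 'u::ab_group_add) \<Rightarrow> bool" where
  "finite_dim s \<longleftrightarrow> (\<exists>S. finite S \<and> module.span s S = UNIV)"

definition isomorphic_reps ::
  "'e cmat set \<Rightarrow> (complex \<Rightarrow> 'u \<Rightarrow> 'u::ab_group_add) \<Rightarrow> ('e cmat \<Rightarrow> 'u \<Rightarrow> 'u) \<Rightarrow>
   (complex \<Rightarrow> 'w \<Rightarrow> 'w::ab_group_add) \<Rightarrow> ('e cmat \<Rightarrow> 'w \<Rightarrow> 'w) \<Rightarrow> bool"
  where
  "isomorphic_reps \<A> s \<rho> s' \<rho>' \<longleftrightarrow>
     (\<exists>\<phi>. Vector_Spaces.linear s s' \<phi> \<and> bij \<phi> \<and> (\<forall>a\<in>\<A>. \<forall>u. \<phi> (\<rho> a u) = \<rho>' a (\<phi> u)))"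

subsection \<open>The polynomials \<open>F\<^sub>i\<close> and the matrices of the two-dimensional representations\<close>

fun F_poly :: "nat \<Rightarrow> nat \<Rightarrow> nat \<Rightarrow> int poly" where
  "F_poly k l 0 = 1"
| "F_poly k l (Suc 0) = [:int k, 1:]"
| "F_poly k l (Suc (Suc i)) = [:0, 1:] * F_poly k l (Suc i) - smult (int (k * l)) (F_poly k l i)"

definition F_roots :: "nat \<Rightarrow> nat \<Rightarrow> nat \<Rightarrow> complex set" where
  "F_roots k l r = {t. poly (map_poly of_int (F_poly k l r)) t = 0}"

definition rho2_M :: "nat \<Rightarrow> complex^2^2" where
  "rho2_M k = vector [vector [of_nat k, 0], vector [0, -1]]"

definition rho2_N :: "nat \<Rightarrow> nat \<Rightarrow> complex \<Rightarrow> complex \<Rightarrow> complex^2^2" where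
  "rho2_N k l t z =
     (let x = (t + of_nat l - 1) / (of_nat k + 1);
          y = (of_nat k * of_nat l - of_nat k - t) / (of_nat k + 1)
      in vector [vector [x, z], vector [z, y]])"

end

theory Submission
  imports Defs
    "HOL-Computational_Algebra.Fundamental_Theorem_Algebra"
    "HOL-Library.Function_Algebras"
begin

text \<open>Let \<open>k + 1\<close>, \<open>l + 1\<close> be the degrees. The matrices satisfy \<open>(M - k)(M + 1) = 0\<close>, \<open>(N - l)(N + 1) = 0\<close>,
  and, since the graph is a tree up to distance \<open>2 r\<close> around a vertex of \<open>B\<close> while no vertex is further
  than \<open>2 r + 1\<close> from it, \<open>(M - k) (N M)\<^sup>r (1 + N) = 0\<close>. The element
  \<open>C = M N + (N - (l - 1)) (M - (k - 1))\<close> is central and \<open>(N M)\<^sup>2 = C N M - k l\<close>, so that the last relation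
  becomes \<open>(M - k) F\<^sub>r(C) (1 + N) = 0\<close>.

  Upper bound: on an irreducible module either \<open>F\<^sub>r(C) (1 + N) \<noteq> 0\<close>, which yields \<open>U\<^sub>1\<^sub>,\<^sub>1\<close>, or \<open>F\<^sub>r(C)\<close> is
  injective and \<open>N = -1\<close>, which yields \<open>U\<^sub>1\<^sub>,\<^sub>2\<close> or \<open>U\<^sub>1\<^sub>,\<^sub>3\<close>, or \<open>C\<close> acts as a root \<open>t\<close> of \<open>F\<^sub>r\<close>, which forces
  \<open>U\<^sub>t\<close>.

  Existence: all representations occur in the space of functions on \<open>E\<close>. The relation gives a polynomial
  of degree \<open>r + 2\<close> in \<open>C\<close> that kills the image of \<open>1 + M\<close>. Two edges whose ends in \<open>A\<close> have distance
  \<open>2 r + 2\<close> show that no polynomial of degree \<open>r + 1\<close> does, so that removing one linear factor from the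
  annihilating polynomial produces eigenvectors for each of its roots. Only \<open>U\<^sub>1\<^sub>,\<^sub>2\<close> is obtained differently,
  from a function with alternating signs on a cycle.\<close>

section \<open>The polynomials \<open>F\<^sub>i\<close>\<close>

definition cF :: "nat \<Rightarrow> nat \<Rightarrow> nat \<Rightarrow> complex poly" where
  "cF k l i = map_poly of_int (F_poly k l i)"

lemma F_roots_eq: "F_roots k l r = {t. poly (cF k l r) t = 0}"
  by (simp add: F_roots_def cF_def)

lemma cF_0: "cF k l 0 = 1"
  by (simp add: cF_def)

lemma cF_Suc_0: "cF k l (Suc 0) = [:of_nat k, 1:]"
  by (simp add: cF_def map_poly_pCons)

lemma cF_Suc_Suc:
  "cF k l (Suc (Suc i)) = pCons 0 (cF k l (Suc i)) - smult (of_nat (k * l)) (cF k l i)"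
  unfolding cF_def
  by (intro poly_eqI) (simp add: coeff_map_poly coeff_pCons split: nat.split)

lemma cF_degree_lead: "degree (cF k l i) = i \<and> lead_coeff (cF k l i) = 1"
proof (induction k l i rule: F_poly.induct)
  case (3 k l i)
  have 1: "degree (pCons 0 (cF k l (Suc i))) = Suc (Suc i)"
    using 3 by (metis degree_pCons_eq degree_0 leading_coeff_0_iff zero_neq_one)
  have 2: "degree (smult (of_nat (k * l)) (cF k l i)) < Suc (Suc i)"
    using 3 by (metis degree_smult_le le_imp_less_Suc less_SucI)
  have "degree (cF k l (Suc (Suc i))) = Suc (Suc i)"
    unfolding cF_Suc_Suc diff_conv_add_uminus
    using 1 2 degree_add_eq_left[of "- smult (of_nat (k * l)) (cF k l i)" "pCons 0 (cF k l (Suc i))"]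
    by simp
  moreover have "coeff (cF k l (Suc (Suc i))) (Suc (Suc i)) = 1"
  proof -
    have "coeff (cF k l (Suc i)) (Suc i) = 1" using 3 by metis
    then show ?thesis using coeff_eq_0[OF 2] unfolding cF_Suc_Suc by auto
  qed
  ultimately show ?case by simp
qed (simp_all add: cF_0 cF_Suc_0)

lemma degree_cF: "degree (cF k l i) = i"
  using cF_degree_lead by blast

lemma cF_nonzero: "cF k l i \<noteq> 0"
  using cF_degree_lead[of k l i] by auto

text \<open>At \<open>X = 1 + k l\<close> the recurrence reads
  \<open>F_{i+2} - F_{i+1} = k l (F_{i+1} - F_i)\<close>, so the values remain positive integers.
  The induction carries two consecutive values \<open>p\<close> and \<open>p + q\<close>.\<close>

lemma poly_cF_one_plus_kl: "poly (cF k l r) (1 + of_nat k * of_nat l) \<noteq> 0"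
proof -
  have "\<exists>p q. poly (cF k l i) (1 + of_nat k * of_nat l) = of_nat p \<and>
     poly (cF k l (Suc i)) (1 + of_nat k * of_nat l) = of_nat (p + q) \<and> p > 0" for i
  proof (induction i)
    case 0
    have "poly (cF k l 0) (1 + of_nat k * of_nat l) = of_nat 1" by (simp add: cF_0)
    moreover have "poly (cF k l (Suc 0)) (1 + of_nat k * of_nat l) = of_nat (1 + (k * l + k))"
      by (simp add: cF_Suc_0)
    ultimately show ?case by (metis zero_less_one)
  next
    case (Suc i)
    then obtain p q where 1: "poly (cF k l i) (1 + of_nat k * of_nat l) = of_nat p"
     "poly (cF k l (Suc i)) (1 + of_nat k * of_nat l) = of_nat (p + q)" "p > 0" by blast
    then have "poly (cF k l (Suc (Suc i))) (1 + of_nat k * of_nat l) = of_nat ((p + q) + k * l * q)"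
      by (simp add: cF_Suc_Suc algebra_simps)
    with 1 show ?case by (metis add_gr_0)
  qed
  from this[of r] show ?thesis by auto
qed

text \<open>At \<open>X = - k - l\<close> the recurrence has characteristic polynomial
  \<open>(s + k) (s + l)\<close>, and the initial values \<open>1\<close>, \<open>- l\<close> select
  the solution \<open>(- l)^i\<close>.\<close>

lemma poly_cF_minus_k_minus_l:
  assumes "l > 0" shows "poly (cF k l r) (- of_nat k - of_nat l) \<noteq> 0"
proof -
  have "poly (cF k l r) (- of_nat k - of_nat l) = (- of_nat l) ^ r"
    by (induction k l r rule: F_poly.induct) (simp_all add: cF_0 cF_Suc_0 cF_Suc_Suc algebra_simps)
  then show ?thesis using assms by simp
qed

lemma of_nat_plus_1_nonzero: "of_nat k + 1 \<noteq> (0 :: complex)"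
  by (metis of_nat_Suc of_nat_eq_0_iff nat.simps(3) add.commute)

text \<open>These are the factors in the numerator of \<open>z^2\<close>, so \<open>z\<close> is
  nonzero at every root. The excluded values are those of \<open>C\<close> on the 1-dimensional
  representations: \<open>1 + k l\<close> on U_{1,1} and U_{1,2}, and \<open>- k - l\<close> on
  U_{1,3}.\<close>

lemma F_root_factors_nonzero:
  assumes "l > 0" "t \<in> F_roots k l r"
  shows "1 + of_nat k * of_nat l - t \<noteq> 0" "t + of_nat k + of_nat l \<noteq> 0"
proof -
  have t: "poly (cF k l r) t = 0" using assms(2) by (simp add: F_roots_eq)
  show "1 + of_nat k * of_nat l - t \<noteq> 0"
    using t poly_cF_one_plus_kl[of k l r] by auto
  show "t + of_nat k + of_nat l \<noteq> 0"
  proof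
    assume "t + of_nat k + of_nat l = 0"
    then have "t = - of_nat k - of_nat l" by (metis add.assoc add_eq_0_iff2 minus_add uminus_add_conv_diff add.commute)
    with t poly_cF_minus_k_minus_l[OF assms(1), of k r] show False by simp
  qed
qed

lemma poly_cF_cnj: "poly (cF k l i) (cnj t) = cnj (poly (cF k l i) t)"
  by (induction k l i rule: F_poly.induct) (simp_all add: cF_0 cF_Suc_0 cF_Suc_Suc)

text \<open>Christoffel--Darboux identity for \<open>t\<close> and \<open>cnj t\<close>; its confluent form gives simplicity of the roots.\<close>

lemma cF_root_real:
  assumes "k * l > 0" "poly (cF k l r) t = 0"
  shows "cnj t = t"
proof -
  let ?f = "\<lambda>i. poly (cF k l i) t"
  \<comment> \<open>The witness built up by the induction is the sum of
    \<open>(k l)^(i - j) |F_j(t)|^2\<close> over \<open>j \<le> i\<close>.\<close>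
  have "\<exists>S::real. S > 0 \<and> ?f (Suc i) * cnj (?f i) - ?f i * cnj (?f (Suc i)) = (t - cnj t) * of_real S" for i
  proof (induction i)
    case 0
    show ?case by (intro exI[of _ 1]) (simp add: cF_0 cF_Suc_0)
  next
    case (Suc i)
    then obtain S :: real where S: "S > 0"
      "?f (Suc i) * cnj (?f i) - ?f i * cnj (?f (Suc i)) = (t - cnj t) * of_real S" by blast
    have "?f (Suc (Suc i)) * cnj (?f (Suc i)) - ?f (Suc i) * cnj (?f (Suc (Suc i)))
      = (t - cnj t) * (?f (Suc i) * cnj (?f (Suc i))) +
        of_nat (k * l) * (?f (Suc i) * cnj (?f i) - ?f i * cnj (?f (Suc i)))"
      by (simp add: cF_Suc_Suc algebra_simps)
    also have "\<dots> = (t - cnj t) * of_real ((cmod (?f (Suc i)))\<^sup>2 + real (k * l) * S)"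
      unfolding S(2) by (simp add: complex_norm_square algebra_simps del: of_real_power)
    finally show ?case using S(1) assms(1)
      by (intro exI[of _ "(cmod (?f (Suc i)))\<^sup>2 + real (k * l) * S"])
        (metis add_nonneg_pos mult_pos_pos of_nat_0_less_iff zero_le_power2)
  qed
  \<comment> \<open>At \<open>i = r - 1\<close> both products contain \<open>F_r(t) = 0\<close> or
    its conjugate. Here \<open>r > 0\<close>, as \<open>F_0 = 1\<close> has no root.\<close>
  note this[of "r - 1"]
  moreover have "Suc (r - 1) = r"
    using assms(2) by (cases r) (auto simp: cF_0)
  ultimately obtain S :: real where "S > 0" "0 = (t - cnj t) * of_real S"
    using assms(2) by auto
  then show ?thesis by simp
qed

lemma cF_root_simple:
  assumes "k * l > 0" "poly (cF k l r) t = 0"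
  shows "poly (pderiv (cF k l r)) t \<noteq> 0"
proof -
  let ?f = "\<lambda>i. poly (cF k l i) t" and ?g = "\<lambda>i. poly (pderiv (cF k l i)) t"
  \<comment> \<open>The root is real, hence so are all \<open>F_i(t)\<close>, and their squares
    below are squared moduli.\<close>
  have real: "cnj (?f i) = ?f i" for i
    using cF_root_real[OF assms] poly_cF_cnj by metis
  have "\<exists>S::real. S > 0 \<and> ?g (Suc i) * ?f i - ?g i * ?f (Suc i) = of_real S" for i
  proof (induction i)
    case 0
    show ?case by (intro exI[of _ 1]) (simp add: cF_0 cF_Suc_0 pderiv_pCons)
  next
    case (Suc i)
    then obtain S :: real where S: "S > 0"
      "?g (Suc i) * ?f i - ?g i * ?f (Suc i) = of_real S" by blast
    have "?g (Suc (Suc i)) * ?f (Suc i) - ?g (Suc i) * ?f (Suc (Suc i))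
      = ?f (Suc i) * cnj (?f (Suc i)) + of_nat (k * l) * (?g (Suc i) * ?f i - ?g i * ?f (Suc i))"
      unfolding real by (simp add: cF_Suc_Suc pderiv_diff pderiv_smult pderiv_pCons algebra_simps)
    also have "\<dots> = of_real ((cmod (?f (Suc i)))\<^sup>2 + real (k * l) * S)"
      unfolding S(2) by (simp add: complex_norm_square algebra_simps del: of_real_power)
    finally show ?case using S(1) assms(1)
      by (intro exI[of _ "(cmod (?f (Suc i)))\<^sup>2 + real (k * l) * S"])
        (metis add_nonneg_pos mult_pos_pos of_nat_0_less_iff zero_le_power2)
  qed
  \<comment> \<open>At \<open>i = r - 1\<close> the term with \<open>F_r(t)\<close> drops out, and
    the derivative times \<open>F_{r-1}(t)\<close> is positive.\<close>
  note this[of "r - 1"]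
  moreover have "Suc (r - 1) = r"
    using assms(2) by (cases r) (auto simp: cF_0)
  ultimately obtain S :: real where "S > 0" "?g r * ?f (r - 1) = of_real S"
    using assms(2) by auto
  then show ?thesis by auto
qed

lemma card_F_roots:
  assumes "k * l > 0" shows "card (F_roots k l r) = r"
proof -
  have "rsquarefree (cF k l r)"
    using cF_root_simple[OF assms] by (auto simp: rsquarefree_roots)
  then have "r = degree (\<Prod>z | poly (cF k l r) z = 0. [:- z, 1:])"
    using complex_poly_decompose_rsquarefree[of "cF k l r"] cF_degree_lead[of k l r]
    by (metis smult_1_left)
  also have "\<dots> = card {z. poly (cF k l r) z = 0}"
    by (subst degree_prod_sum_eq) simp_all
  finally show ?thesis by (simp add: F_roots_eq)
qed

section \<open>Modules over the relations\<close>

locale linear_operator = vector_space scale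
  for scale :: "complex \<Rightarrow> 'u::ab_group_add \<Rightarrow> 'u" (infixr "\<odot>" 75) +
  fixes c :: "'u \<Rightarrow> 'u"
  assumes linear_c: "Vector_Spaces.linear scale scale c"
begin

lemma c_simps [simp]: "c 0 = 0" "c (v + w) = c v + c w" "c (v - w) = c v - c w" "c (a \<odot> v) = a \<odot> c v" "c (- v) = - c v"
  "c (sum f X) = (\<Sum>x\<in>X. c (f x))"
proof -
  interpret c: Vector_Spaces.linear scale scale c by (rule linear_c)
  show "c 0 = 0" "c (v + w) = c v + c w" "c (v - w) = c v - c w" "c (a \<odot> v) = a \<odot> c v" "c (- v) = - c v"
  "c (sum f X) = (\<Sum>x\<in>X. c (f x))"
    by (simp_all add: c.zero c.add c.diff c.scale c.neg c.sum)
qed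

definition poly_op :: "complex poly \<Rightarrow> 'u \<Rightarrow> 'u" where
  "poly_op p v = (\<Sum>i\<le>degree p. coeff p i \<odot> (c ^^ i) v)"

lemma poly_op_0 [simp]: "poly_op 0 v = 0"
  by (simp add: poly_op_def)

lemma poly_op_pCons [simp]: "poly_op (pCons a p) v = a \<odot> v + c (poly_op p v)"
  by (cases "p = 0") (simp_all add: poly_op_def sum.atMost_Suc_shift del: sum.atMost_Suc)

lemma poly_op_1 [simp]: "poly_op 1 v = v"
  by (simp add: one_pCons)

lemma poly_op_add: "poly_op (p + q) v = poly_op p v + poly_op q v"
  by (induction p q rule: poly_induct2) (simp_all add: algebra_simps)

lemma poly_op_smult: "poly_op (smult a p) v = a \<odot> poly_op p v"
  by (induction p) (simp_all add: algebra_simps)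

lemma poly_op_diff: "poly_op (p - q) v = poly_op p v - poly_op q v"
  using poly_op_add[of p "smult (- 1) q" v] unfolding poly_op_smult by simp

lemma poly_op_mult: "poly_op (p * q) v = poly_op p (poly_op q v)"
  by (induction p) (simp_all add: poly_op_add poly_op_smult)

lemma poly_op_commute:
  assumes "\<And>v. f (c v) = c (f v)" "\<And>v w. f (v + w) = f v + f w" "\<And>a v. f (a \<odot> v) = a \<odot> f v"
  shows "f (poly_op p v) = poly_op p (f v)"
proof -
  have "f 0 = 0" using assms(2)[of 0 0] by simp
  then show ?thesis by (induction p) (simp_all add: assms)
qed

lemma poly_op_scale: "poly_op p (a \<odot> v) = a \<odot> poly_op p v"
  by (induction p) (simp_all add: algebra_simps)

lemma linear_poly_op: "Vector_Spaces.linear scale scale (poly_op p)"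
proof -
  have "poly_op p (v + w) = poly_op p v + poly_op p w" for v w
    by (induction p) (simp_all add: algebra_simps)
  then show ?thesis
    by (simp add: poly_op_scale Vector_Spaces.linear_def module_hom_def module_hom_axioms_def vector_space_axioms module_axioms)
qed

text \<open>Split off a root, \<open>p = (X - t) q\<close>. Either \<open>q(c) u\<close> is nonzero
  and an eigenvector for \<open>t\<close>, or \<open>q\<close> annihilates \<open>u\<close> as well
  and has smaller degree.\<close>

lemma eigenvector_of_annihilating_poly:
  assumes "poly_op p u = 0" "u \<noteq> 0" "p \<noteq> 0"
  shows "\<exists>t v. poly p t = 0 \<and> v \<noteq> 0 \<and> c v = t \<odot> v"
  using assms
proof (induction "degree p" arbitrary: p)
  case 0
  then obtain a where "p = [:a:]" by (metis degree_eq_zeroE)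
  with 0 show ?case by simp
next
  case (Suc d)
  then obtain t where t: "poly p t = 0"
    using fundamental_theorem_of_algebra[of p] by (metis constant_degree nat.simps(3))
  then obtain q where q: "p = [:-t, 1:] * q" by (metis poly_eq_0_iff_dvd dvdE)
  with Suc.prems have "q \<noteq> 0" by auto
  then have deg: "degree p = Suc (degree q)" by (simp add: q degree_mult_eq del: mult_pCons_left)
  show ?case
  proof (cases "poly_op q u = 0")
    case True
    then obtain t' v where "poly q t' = 0 \<and> v \<noteq> 0 \<and> c v = t' \<odot> v"
      using Suc.hyps(1)[of q] Suc.hyps(2) deg \<open>q \<noteq> 0\<close> \<open>u \<noteq> 0\<close> by auto
    then show ?thesis by (metis q poly_mult mult_zero_right)
  next
    case False
    have "c (poly_op q u) = t \<odot> poly_op q u"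
      using Suc.prems(1) unfolding q poly_op_mult by (simp add: algebra_simps)
    with False t show ?thesis by blast
  qed
qed

end

section \<open>Two operators with the quadratic relations and the long relation\<close>

locale hecke_module = vector_space scale
  for scale :: "complex \<Rightarrow> 'u::ab_group_add \<Rightarrow> 'u" (infixr "\<odot>" 75) +
  fixes m n :: "'u \<Rightarrow> 'u" and k l r :: nat
  assumes linear_m: "Vector_Spaces.linear scale scale m"
    and linear_n: "Vector_Spaces.linear scale scale n"
    and m_quadratic: "m (m v) = (of_nat k - 1) \<odot> m v + of_nat k \<odot> v"
    and n_quadratic: "n (n v) = (of_nat l - 1) \<odot> n v + of_nat l \<odot> v"
    and long_relation: "m (((n \<circ> m) ^^ r) (v + n v)) = of_nat k \<odot> ((n \<circ> m) ^^ r) (v + n v)"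
begin

sublocale m: linear_operator scale m
  by (intro linear_operator.intro linear_operator_axioms.intro vector_space_axioms linear_m)
sublocale n: linear_operator scale n
  by (intro linear_operator.intro linear_operator_axioms.intro vector_space_axioms linear_n)

text \<open>For \<open>k, l > 0\<close> the quadratic relations say
  \<open>M - (k - 1) = k M^{-1}\<close> and \<open>N - (l - 1) = l N^{-1}\<close>, so that
  \<open>C = M N + k l (M N)^{-1} = N M + k l (N M)^{-1}\<close>. This is the source of its
  centrality and of \<open>nm_quadratic\<close>.\<close>

definition C :: "'u \<Rightarrow> 'u" where
  "C v = m (n v) + n (m v) - (of_nat k - 1) \<odot> n v - (of_nat l - 1) \<odot> m v
    + ((of_nat k - 1) * (of_nat l - 1)) \<odot> v"

sublocale C: linear_operator scale C
  by unfold_locales (simp_all add: C_def algebra_simps Vector_Spaces.linear_def module_hom_def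
      module_hom_axioms_def vector_space_axioms module_axioms)

text \<open>Here \<open>C + (k + l)\<close> becomes \<open>(1 + M) (1 + N)\<close>. On functions on
  the edges both factors are sums over edges at a common vertex, which makes the growth of supports
  visible in \<open>C_power_support\<close>.\<close>

lemma C_on_m_eigenspace:
  assumes "m g = of_nat k \<odot> g"
  shows "C g = (g + n g) + m (g + n g) - (of_nat k + of_nat l) \<odot> g"
  by (simp add: C_def assms algebra_simps)

lemma m_C: "m (C v) = C (m v)"
  by (simp add: C_def m_quadratic algebra_simps)

lemma n_C: "n (C v) = C (n v)"
  by (simp add: C_def n_quadratic algebra_simps)

lemma n_poly_C: "n (C.poly_op p v) = C.poly_op p (n v)"
  and m_poly_C: "m (C.poly_op p v) = C.poly_op p (m v)"
  by (rule C.poly_op_commute, simp_all add: m_C n_C)+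

lemma nm_quadratic: "n (m (n (m v))) = C (n (m v)) - of_nat (k * l) \<odot> v"
  by (simp add: C_def m_quadratic n_quadratic algebra_simps)

abbreviation F :: "'u \<Rightarrow> 'u" where "F \<equiv> C.poly_op (cF k l r)"

text \<open>By \<open>nm_quadratic\<close> the powers \<open>(N M)^i\<close> and the operators
  \<open>F_i(C)\<close> obey the same recurrence. It is therefore enough that they agree on the
  image of \<open>1 + N\<close>, after applying \<open>M - k\<close>, for \<open>i = 0\<close> and
  \<open>i = 1\<close>.\<close>

lemma m_F_plus: "m (F (v + n v)) = of_nat k \<odot> F (v + n v)"
proof -
  let ?b = "v + n v"
  have rec: "((n \<circ> m) ^^ Suc (Suc i)) w = C (((n \<circ> m) ^^ Suc i) w) - of_nat (k * l) \<odot> ((n \<circ> m) ^^ i) w" for i w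
    using nm_quadratic by simp
  have "m (((n \<circ> m) ^^ i) ?b) - of_nat k \<odot> ((n \<circ> m) ^^ i) ?b
    = m (C.poly_op (cF k l i) ?b) - of_nat k \<odot> C.poly_op (cF k l i) ?b" for i
  proof (induction i rule: induct_nat_012)
    case 0
    then show ?case by (simp add: cF_0)
  next
    case 1
    \<comment> \<open>As \<open>n\<close> acts on \<open>?b\<close> as \<open>l\<close>, one gets
      \<open>(k + C) ?b = n (m ?b) + (1 + m) ?b\<close>, and \<open>m - k\<close> kills the last
      term. This is why \<open>F_1\<close> is \<open>X + k\<close> and not \<open>X\<close>.\<close>
    have "C.poly_op (cF k l (Suc 0)) w = of_nat k \<odot> w + C w" for w
      by (simp add: cF_Suc_0)
    note eq = this
    show ?case unfolding eq by (simp add: C_def m_quadratic n_quadratic algebra_simps)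
  next
    case (ge2 i)
    have "m (((n \<circ> m) ^^ Suc (Suc i)) ?b) - of_nat k \<odot> ((n \<circ> m) ^^ Suc (Suc i)) ?b
      = C (m (((n \<circ> m) ^^ Suc i) ?b) - of_nat k \<odot> ((n \<circ> m) ^^ Suc i) ?b)
        - of_nat (k * l) \<odot> (m (((n \<circ> m) ^^ i) ?b) - of_nat k \<odot> ((n \<circ> m) ^^ i) ?b)"
      unfolding rec by (simp add: m_C algebra_simps del: of_nat_mult)
    also have "\<dots> = m (C.poly_op (cF k l (Suc (Suc i))) ?b) - of_nat k \<odot> C.poly_op (cF k l (Suc (Suc i))) ?b"
      unfolding ge2 cF_Suc_Suc
      by (simp add: C.poly_op_diff C.poly_op_smult m_C algebra_simps del: of_nat_mult)
    finally show ?case .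
  qed
  then show ?thesis using long_relation[of v] by (metis eq_iff_diff_eq_0)
qed


lemma m_plus: "m (v + m v) = of_nat k \<odot> (v + m v)" and n_plus: "n (v + n v) = of_nat l \<odot> (v + n v)"
  by (simp_all add: m_quadratic n_quadratic algebra_simps)

text \<open>\<open>F_r(C)\<close> kills every U_t and \<open>C - (1 + k l)\<close> kills U_{1,1} and
  U_{1,2}, so that this operator leaves only U_{1,3}.\<close>

definition U13_vector :: "'u \<Rightarrow> 'u" where
  "U13_vector v = C.poly_op (cF k l r * [:- (1 + of_nat k * of_nat l), 1:]) (v + m v)"

lemma m_U13_vector: "m (U13_vector v) = of_nat k \<odot> U13_vector v"
  unfolding U13_vector_def m_poly_C m_plus by (rule C.poly_op_scale)

text \<open>With \<open>a = (1 + m) v\<close> and \<open>b = (1 + n) a\<close>, computing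
  \<open>(1 + n) (1 + m) F_r(C) b\<close> in two ways shows that \<open>C\<close> acts on
  \<open>F_r(C) b\<close> as \<open>1 + k l\<close>; hence \<open>1 + n\<close> kills the
  vector.\<close>

lemma n_U13_vector: "n (U13_vector v) = - U13_vector v"
proof -
  let ?a = "v + m v" and ?P = "C.poly_op (cF k l r)"
  let ?b = "?a + n ?a"
  interpret P: linear_operator scale ?P
    by (intro linear_operator.intro linear_operator_axioms.intro vector_space_axioms C.linear_poly_op)
  \<comment> \<open>\<open>?a\<close> is a \<open>k\<close>-eigenvector of \<open>m\<close>, so this
    is the form of \<open>C\<close> from \<open>C_on_m_eigenspace\<close>.\<close>
  have eq: "?b + m ?b = C ?a + (of_nat k + of_nat l) \<odot> ?a"
    by (simp add: C_def m_quadratic n_quadratic algebra_simps)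
  define B D where "B = ?P ?b" and "D = ?P (C ?b)"
  have "?P (?b + m ?b) = of_nat (k + 1) \<odot> B"
    unfolding B_def using m_F_plus[of ?a] by (simp add: m_poly_C[symmetric] algebra_simps)
  moreover have "?P (?b + m ?b) + n (?P (?b + m ?b)) = D + (of_nat k + of_nat l) \<odot> B"
    unfolding eq n_poly_C B_def D_def by (simp add: n_C algebra_simps)
  moreover have "n B = of_nat l \<odot> B"
    unfolding B_def n_poly_C n_plus by simp
  \<comment> \<open>Comparison gives \<open>(k + 1) (l + 1) B = D + (k + l) B\<close>.\<close>
  ultimately have "D = (1 + of_nat k * of_nat l) \<odot> B"
    by (simp add: algebra_simps)
  then have *: "?P (C ?b) = (1 + of_nat k * of_nat l) \<odot> ?P ?b"
    unfolding B_def D_def .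
  have U13_vector: "U13_vector v = ?P (C ?a) - (1 + of_nat k * of_nat l) \<odot> ?P ?a"
    unfolding U13_vector_def C.poly_op_mult by (simp add: algebra_simps)
  have "U13_vector v + n (U13_vector v) = ?P (C ?b) - (1 + of_nat k * of_nat l) \<odot> ?P ?b"
    unfolding U13_vector by (simp add: n_poly_C n_C algebra_simps)
  with * show ?thesis by (metis add_eq_0_iff right_minus_eq)
qed

text \<open>\<open>U13_vector v\<close> is a common eigenvector of \<open>m\<close> and
  \<open>n\<close> for \<open>k\<close> and \<open>-1\<close>, where \<open>C\<close> takes the
  value \<open>- k - l\<close>; one more linear factor kills it.\<close>

lemma C_annihilated:
  "C.poly_op (cF k l r * [:- (1 + of_nat k * of_nat l), 1:] * [:of_nat k + of_nat l, 1:]) (v + m v) = 0"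
proof -
  have "C.poly_op (cF k l r * [:- (1 + of_nat k * of_nat l), 1:] * [:of_nat k + of_nat l, 1:]) (v + m v)
    = C.poly_op [:of_nat k + of_nat l, 1:] (U13_vector v)"
    unfolding U13_vector_def C.poly_op_mult[symmetric] by (simp only: mult.commute)
  also have "\<dots> = (of_nat k + of_nat l) \<odot> U13_vector v + C (U13_vector v)"
    by simp
  also have "\<dots> = 0"
    by (simp add: C_def m_U13_vector n_U13_vector algebra_simps)
  finally show ?thesis .
qed

text \<open>Leaving the factor \<open>X - t\<close> out of the annihilating polynomial gives a
  vector killed by \<open>C - t\<close>. It stays in the \<open>k\<close>-eigenspace of
  \<open>m\<close> because \<open>m\<close> commutes with \<open>C\<close>. That it can be nonzero
  comes from \<open>poly_C_nonzero\<close>.\<close>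

lemma C_eigenvector:
  fixes v
  assumes "cF k l r = [:- t, 1:] * q"
  defines "w \<equiv> C.poly_op (q * [:- (1 + of_nat k * of_nat l), 1:] * [:of_nat k + of_nat l, 1:]) (v + m v)"
  shows "C w = t \<odot> w" "m w = of_nat k \<odot> w"
proof -
  have "C.poly_op [:- t, 1:] w = 0"
    using C_annihilated[of v] unfolding w_def assms(1) C.poly_op_mult[symmetric] by (simp only: mult.assoc)
  then show "C w = t \<odot> w"
    by simp
  show "m w = of_nat k \<odot> w"
    unfolding w_def m_poly_C m_plus by (rule C.poly_op_scale)
qed

text \<open>The second basis vector is read off from \<open>n e\<^sub>1\<close>: the eigenvalue of
  \<open>C\<close> makes it a \<open>-1\<close>-eigenvector of \<open>m\<close>, and the quadratic
  relation for \<open>n\<close> determines its image under \<open>n\<close>.\<close>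

lemma rank_two_submodule:
  assumes "e\<^sub>1 \<noteq> 0" "m e\<^sub>1 = of_nat k \<odot> e\<^sub>1" "C e\<^sub>1 = t \<odot> e\<^sub>1" "z \<noteq> 0"
    and z: "z\<^sup>2 = (1 + of_nat k * of_nat l - t) * (t + of_nat k + of_nat l) / (of_nat k + 1)\<^sup>2"
  shows "\<exists>\<phi>. Vector_Spaces.linear (*s) scale \<phi> \<and> inj \<phi> \<and>
    (\<forall>u. m (\<phi> u) = \<phi> (rho2_M k *v u)) \<and> (\<forall>u. n (\<phi> u) = \<phi> (rho2_N k l t z *v u))"
proof -
  define x y where "x = (t + of_nat l - 1) / (of_nat k + 1)"
    and "y = (of_nat k * of_nat l - of_nat k - t) / (of_nat k + 1)"
  note k1 = of_nat_plus_1_nonzero[of k]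
  have xk: "x * (of_nat k + 1) = t + of_nat l - 1" and yk: "y * (of_nat k + 1) = of_nat k * of_nat l - of_nat k - t"
    using k1 by (simp_all add: x_def y_def)
  have "(x + y) * (of_nat k + 1) = (of_nat l - 1) * (of_nat k + 1)"
    unfolding distrib_right xk yk by (simp add: algebra_simps)
  then have "x + y = of_nat l - 1" using k1 mult_cancel_right by blast
  then have xy: "y = of_nat l - 1 - x" by (simp add: algebra_simps)
  \<comment> \<open>The matrix of \<open>N\<close> has eigenvalues \<open>l\<close> and
    \<open>-1\<close>: its trace is \<open>x + y = l - 1\<close>, and its determinant
    \<open>x y - z^2 = - l\<close> is the identity sought.\<close>
  have "z\<^sup>2 * (of_nat k + 1)\<^sup>2 = (x * y + of_nat l) * (of_nat k + 1)\<^sup>2"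
  proof -
    have "(x * y + of_nat l) * (of_nat k + 1)\<^sup>2
      = (x * (of_nat k + 1)) * (y * (of_nat k + 1)) + of_nat l * (of_nat k + 1)\<^sup>2"
      by (simp add: power2_eq_square algebra_simps)
    also have "\<dots> = (1 + of_nat k * of_nat l - t) * (t + of_nat k + of_nat l)"
      unfolding xk yk by (simp add: power2_eq_square algebra_simps)
    finally show ?thesis unfolding z using k1 by simp
  qed
  then have zz: "z * z = x * y + of_nat l" using k1 by (simp add: power2_eq_square)
  \<comment> \<open>Forced by the first column of the matrix of \<open>N\<close>.\<close>
  define e\<^sub>2 where "e\<^sub>2 = (1 / z) \<odot> (n e\<^sub>1 - x \<odot> e\<^sub>1)"
  have n1: "n e\<^sub>1 = x \<odot> e\<^sub>1 + z \<odot> e\<^sub>2"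
    using \<open>z \<noteq> 0\<close> by (simp add: e\<^sub>2_def)
  \<comment> \<open>On the \<open>k\<close>-eigenspace of \<open>m\<close>,
    \<open>C e\<^sub>1 = t e\<^sub>1\<close> amounts to
    \<open>(1 + m) n e\<^sub>1 = (t + l - 1) e\<^sub>1\<close>.\<close>
  have "m (n e\<^sub>1) + n e\<^sub>1 = (x * (of_nat k + 1)) \<odot> e\<^sub>1"
    using assms(3) unfolding xk C_def by (simp add: assms(2) algebra_simps)
  then have "z \<odot> (m e\<^sub>2 + e\<^sub>2) = 0"
    unfolding n1 by (simp add: assms(2) algebra_simps)
  then have m2: "m e\<^sub>2 = - e\<^sub>2"
    using \<open>z \<noteq> 0\<close> by (simp add: add_eq_0_iff2)
  have "z \<odot> n e\<^sub>2 = n (n e\<^sub>1) - x \<odot> n e\<^sub>1"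
    using \<open>z \<noteq> 0\<close> by (simp add: e\<^sub>2_def)
  also have "\<dots> = y \<odot> (n e\<^sub>1) + of_nat l \<odot> e\<^sub>1"
    unfolding n_quadratic xy by (simp add: algebra_simps)
  also have "\<dots> = (x * y + of_nat l) \<odot> e\<^sub>1 + (z * y) \<odot> e\<^sub>2"
    unfolding n1 by (simp add: algebra_simps)
  also have "\<dots> = z \<odot> (z \<odot> e\<^sub>1 + y \<odot> e\<^sub>2)"
    unfolding zz[symmetric] by (simp add: algebra_simps)
  finally have n2: "n e\<^sub>2 = z \<odot> e\<^sub>1 + y \<odot> e\<^sub>2"
    using \<open>z \<noteq> 0\<close> by simp
  define \<phi> where "\<phi> u = (u $ 1) \<odot> e\<^sub>1 + (u $ 2) \<odot> e\<^sub>2" for u :: "complex^2"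
  have lin: "Vector_Spaces.linear (*s) scale \<phi>"
    by (simp add: Vector_Spaces.linear_def module_hom_def module_hom_axioms_def vector_space_axioms
        module_axioms vec.vector_space_axioms vec.module_axioms \<phi>_def algebra_simps)
  interpret \<phi>: Vector_Spaces.linear "(*s)" scale \<phi> by (rule lin)
  have "u = 0" if u: "\<phi> u = 0" for u
  proof -
    \<comment> \<open>\<open>1 + m\<close> kills \<open>e\<^sub>2\<close> and so isolates the first
      coordinate.\<close>
    have "m (\<phi> u) + \<phi> u = ((u $ 1) * (of_nat k + 1)) \<odot> e\<^sub>1"
      by (simp add: \<phi>_def m2 assms(2) algebra_simps)
    then have u1: "u $ 1 = 0" using u k1 assms(1) by simp
    have "e\<^sub>2 \<noteq> 0" using n2 \<open>z \<noteq> 0\<close> assms(1) by auto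
    then have "u $ 2 = 0" using u u1 by (simp add: \<phi>_def)
    with u1 show ?thesis by (simp add: vec_eq_iff forall_2)
  qed
  then have "inj \<phi>" by (simp add: \<phi>.inj_iff_eq_0)
  moreover have "m (\<phi> u) = \<phi> (rho2_M k *v u)" for u
    by (simp add: \<phi>_def rho2_M_def matrix_vector_mult_def sum_2 assms(2) m2 algebra_simps)
  moreover have "rho2_N k l t z = vector [vector [x, z], vector [z, y]]"
    by (simp only: rho2_N_def Let_def x_def y_def)
  then have "n (\<phi> u) = \<phi> (rho2_N k l t z *v u)" for u
    by (simp add: \<phi>_def matrix_vector_mult_def sum_2 n1 n2 algebra_simps)
  ultimately show ?thesis using lin by blast
qed

section \<open>Classification of the irreducible modules\<close>

definition irreducible_module :: bool where
  "irreducible_module \<longleftrightarrow> (\<forall>W. subspace W \<and> m ` W \<subseteq> W \<and> n ` W \<subseteq> W \<longrightarrow> W = {0} \<or> W = UNIV)"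

text \<open>The image is an invariant subspace, and nonzero because of \<open>u\<^sub>0\<close>, so
  irreducibility makes it the whole space.\<close>

lemma bij_of_injective_intertwiner:
  fixes \<phi> :: "'w::ab_group_add \<Rightarrow> 'u" and u\<^sub>0 :: 'w
  assumes irreducible_module
    and lin: "Vector_Spaces.linear s' scale \<phi>" and "inj \<phi>"
    and "\<And>u. m (\<phi> u) = \<phi> (m' u)" "\<And>u. n (\<phi> u) = \<phi> (n' u)" and "u\<^sub>0 \<noteq> 0"
  shows "bij \<phi>"
proof -
  interpret \<phi>: Vector_Spaces.linear s' scale \<phi> by (rule lin)
  have "subspace (range \<phi>)" by (simp add: \<phi>.subspace_image \<phi>.vs1.subspace_UNIV)
  moreover have "m ` range \<phi> \<subseteq> range \<phi>" "n ` range \<phi> \<subseteq> range \<phi>" using assms(4,5) by auto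
  moreover have "\<phi> u\<^sub>0 \<noteq> 0" using assms(3,6) \<phi>.zero by (metis injD)
  ultimately have "range \<phi> = UNIV" using assms(1) unfolding irreducible_module_def by blast
  with assms(3) show ?thesis by (simp add: bij_def)
qed

lemma rank_one_irreducible:
  assumes irreducible_module "v \<noteq> 0" "m v = \<mu> \<odot> v" "n v = \<nu> \<odot> v"
  shows "\<exists>\<phi>. Vector_Spaces.linear (*) scale \<phi> \<and> bij \<phi> \<and>
    (\<forall>u. m (\<phi> u) = \<phi> (\<mu> * u)) \<and> (\<forall>u. n (\<phi> u) = \<phi> (\<nu> * u))"
proof -
  let ?\<phi> = "\<lambda>u. u \<odot> v"
  have vs: "vector_space ((*) :: complex \<Rightarrow> complex \<Rightarrow> complex)"
    by unfold_locales (simp_all add: algebra_simps)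
  have lin: "Vector_Spaces.linear (*) scale ?\<phi>"
    by (simp add: Vector_Spaces.linear_def module_hom_def module_hom_axioms_def vector_space_axioms
        module_axioms vs vs[unfolded module_iff_vector_space[symmetric]] algebra_simps)
  moreover have "inj ?\<phi>" using assms(2) by (auto intro: injI)
  moreover have mn: "m (?\<phi> u) = ?\<phi> (\<mu> * u)" "n (?\<phi> u) = ?\<phi> (\<nu> * u)" for u
    by (simp_all add: assms(3,4) mult.commute)
  ultimately have "bij ?\<phi>"
    using bij_of_injective_intertwiner[OF assms(1) lin _ mn, of 1] by simp
  with lin mn show ?thesis by blast
qed

lemma irreducible_module_cases:
  assumes irr: irreducible_module and "(UNIV :: 'u set) \<noteq> {0}" and "l > 0"
    and z: "\<And>t. t \<in> F_roots k l r \<Longrightarrow>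
      (z t)\<^sup>2 = (1 + of_nat k * of_nat l - t) * (t + of_nat k + of_nat l) / (of_nat k + 1)\<^sup>2"
  shows "(\<exists>(\<mu>, \<nu>) \<in> {(of_nat k, of_nat l), (-1, -1), (of_nat k, -1)}.
      \<exists>\<phi>. Vector_Spaces.linear (*) scale \<phi> \<and> bij \<phi> \<and>
        (\<forall>u. m (\<phi> u) = \<phi> (\<mu> * u)) \<and> (\<forall>u. n (\<phi> u) = \<phi> (\<nu> * u))) \<or>
    (\<exists>t \<in> F_roots k l r. \<exists>\<phi>. Vector_Spaces.linear (*s) scale \<phi> \<and> bij \<phi> \<and>
        (\<forall>u. m (\<phi> u) = \<phi> (rho2_M k *v u)) \<and> (\<forall>u. n (\<phi> u) = \<phi> (rho2_N k l t (z t) *v u)))"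
    (is "?one \<or> ?two")
proof (cases "\<forall>v. F (v + n v) = 0")
  case False
  then obtain v where "F (v + n v) \<noteq> 0" by blast
  \<comment> \<open>\<open>F (v + n v)\<close> is a common eigenvector for \<open>k\<close> and
    \<open>l\<close>: this is U_{1,1}.\<close>
  moreover have "n (F (v + n v)) = of_nat l \<odot> F (v + n v)"
    unfolding n_poly_C n_plus by (rule C.poly_op_scale)
  ultimately show ?thesis
    using rank_one_irreducible[OF irr _ m_F_plus] by blast
next
  case F0: True
  show ?thesis
  proof (cases "\<exists>u. u \<noteq> 0 \<and> F u = 0")
    case False
    \<comment> \<open>\<open>F\<close> is injective here, so \<open>n = -1\<close>. Then
      \<open>m\<close> decides: a nonzero \<open>v + m v\<close> is a \<open>k\<close>-eigenvector
      and gives U_{1,3}, otherwise \<open>m = -1\<close> gives U_{1,2}.\<close>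
    then have "v + n v = 0" for v using F0 by blast
    then have n: "n v = (-1) \<odot> v" for v by (simp add: add_eq_0_iff)
    show ?thesis
    proof (cases "\<exists>v. v + m v \<noteq> 0")
      case True
      then show ?thesis using rank_one_irreducible[OF irr _ m_plus n] by blast
    next
      case False
      then have "m v = (-1) \<odot> v" for v by (simp add: add_eq_0_iff)
      moreover obtain v :: 'u where "v \<noteq> 0" using assms(2) by blast
      ultimately show ?thesis using rank_one_irreducible[OF irr _ _ n] by blast
    qed
  next
    case True
    then obtain t e where t: "poly (cF k l r) t = 0" "e \<noteq> 0" "C e = t \<odot> e"
      using C.eigenvector_of_annihilating_poly cF_nonzero by blast
    \<comment> \<open>As in Schur's lemma: an eigenspace of the central \<open>C\<close> is a
      submodule, so \<open>C\<close> is the scalar \<open>t\<close>.\<close>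
    let ?W = "{v. C v = t \<odot> v}"
    have "subspace ?W" by (auto simp: subspace_def algebra_simps)
    moreover have "m ` ?W \<subseteq> ?W" "n ` ?W \<subseteq> ?W"
      by (auto simp: m_C[symmetric] n_C[symmetric])
    ultimately have "?W = UNIV" using irr t(2,3) unfolding irreducible_module_def by blast
    then have C: "C v = t \<odot> v" for v by blast
    have tR: "t \<in> F_roots k l r" using t(1) by (simp add: F_roots_eq)
    have z0: "z t \<noteq> 0"
      using F_root_factors_nonzero[OF \<open>l > 0\<close> tR] z[OF tR] of_nat_plus_1_nonzero[of k] by auto
    show ?thesis
    proof (cases "\<exists>v. v + m v \<noteq> 0")
      case True
      then obtain v where "v + m v \<noteq> 0" by blast
      then obtain \<phi> where \<phi>: "Vector_Spaces.linear (*s) scale \<phi>" "inj \<phi>"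
        "\<And>u. m (\<phi> u) = \<phi> (rho2_M k *v u)" "\<And>u. n (\<phi> u) = \<phi> (rho2_N k l t (z t) *v u)"
        using rank_two_submodule[OF _ m_plus C z0 z[OF tR]] by blast
      have "bij \<phi>"
        using bij_of_injective_intertwiner[OF irr \<phi>, of 1] by simp
      with \<phi> tR show ?thesis by blast
    next
      case False
      then have m: "m v = - v" for v by (simp add: add_eq_0_iff)
      \<comment> \<open>With \<open>m = -1\<close>, the equation \<open>C = t\<close> makes
        \<open>n\<close> the scalar \<open>y / (k + 1)\<close>, which must satisfy the quadratic
        relation of \<open>n\<close>.\<close>
      define y where "y = of_nat k * of_nat l - of_nat k - t"
      have y: "(of_nat k + 1) \<odot> n v = y \<odot> v" for v
        using C[of v] unfolding C_def m y_def by (simp add: algebra_simps)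
      have "(y * y) \<odot> e = (of_nat k + 1) \<odot> n ((of_nat k + 1) \<odot> n e)"
      proof -
        have "(of_nat k + 1) \<odot> n ((of_nat k + 1) \<odot> n e) = y \<odot> ((of_nat k + 1) \<odot> n e)"
          by (subst (2) y) (simp add: mult.commute)
        then show ?thesis unfolding y by simp
      qed
      also have "\<dots> = ((of_nat k + 1) * (of_nat k + 1)) \<odot> n (n e)"
        by simp
      also have "\<dots> = ((of_nat k + 1) * (of_nat l - 1)) \<odot> ((of_nat k + 1) \<odot> n e)
          + ((of_nat k + 1) * (of_nat k + 1) * of_nat l) \<odot> e"
        unfolding n_quadratic by (simp add: scale_right_distrib mult_ac)
      also have "\<dots> = ((of_nat k + 1) * (of_nat l - 1) * y + (of_nat k + 1) * (of_nat k + 1) * of_nat l) \<odot> e"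
        unfolding y by (simp add: algebra_simps)
      finally have "y * y = (of_nat k + 1) * (of_nat l - 1) * y + (of_nat k + 1) * (of_nat k + 1) * of_nat l"
        using t(2) by simp
      \<comment> \<open>The quadratic equation for \<open>y\<close> has the roots
        \<open>- (k + 1)\<close> and \<open>l (k + 1)\<close>; the two factors are
        \<open>y + (k + 1)\<close> and \<open>l (k + 1) - y\<close>.\<close>
      then have "(1 + of_nat k * of_nat l - t) * (t + of_nat k + of_nat l) = 0"
        unfolding y_def by (simp add: algebra_simps)
      with F_root_factors_nonzero[OF \<open>l > 0\<close> tR] show ?thesis by simp
    qed
  qed
qed

end

section \<open>Graphs of girth deficiency two\<close>

lemma successively_nth: "successively P xs \<Longrightarrow> Suc i < length xs \<Longrightarrow> P (xs ! i) (xs ! Suc i)"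
proof (induction P xs arbitrary: i rule: successively.induct)
  case (3 P x y xs)
  then show ?case by (cases i) auto
qed auto

section \<open>Distances and short cycles in a bipartite graph\<close>

locale bipartite_graph =
  fixes V :: "'v set" and E :: "'v set set" and A B :: "'v set"
  assumes connected: "connected_graph V E"
    and bip: "bipartition V E A B"
begin

lemma finite_V: "finite V" and edge_subset: "e \<in> E \<Longrightarrow> e \<subseteq> V" and card_edge: "e \<in> E \<Longrightarrow> card e = 2"
  using connected by (auto simp: connected_graph_def simple_graph_def)

lemma finite_E: "finite E"
  using finite_V edge_subset by (meson PowI finite_Pow_iff finite_subset subsetI)

lemma AB: "A \<union> B = V" "A \<inter> B = {}"
  using bip by (auto simp: bipartition_def)

definition end_in :: "'v set \<Rightarrow> 'v set \<Rightarrow> 'v" where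
  "end_in D e = the_elem (e \<inter> D)"

lemma edge_cases:
  assumes "e \<in> E"
  obtains a b where "a \<in> A" "b \<in> B" "e = {a, b}" "end_in A e = a" "end_in B e = b" "e \<inter> A = {a}" "e \<inter> B = {b}"
proof -
  obtain a b where ab: "a \<in> A" "b \<in> B" "e = {a, b}"
    using assms bip unfolding bipartition_def by blast
  then have eA: "e \<inter> A = {a}" and eB: "e \<inter> B = {b}" using AB(2) by auto
  have "end_in A e = a" "end_in B e = b" unfolding end_in_def eA eB by simp_all
  from that[OF ab this eA eB] show ?thesis .
qed

lemma end_in_eq_iff:
  assumes "e \<in> E" "f \<in> E" "D \<in> {A, B}"
  shows "e \<inter> D = f \<inter> D \<longleftrightarrow> end_in D e = end_in D f"
  by (rule edge_cases[OF assms(1)], rule edge_cases[OF assms(2)]) (use assms(3) in auto)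

lemma adj_rel_iff: "(u, v) \<in> adj_rel E \<longleftrightarrow> {u, v} \<in> E"
proof -
  have "{u, v} \<in> E \<Longrightarrow> u \<noteq> v" using card_edge[of "{u, v}"] by (auto simp: card_insert_if split: if_splits)
  then show ?thesis by (auto simp: adj_rel_def)
qed

lemma gdist_walk:
  assumes "u \<in> V" "v \<in> V" shows "(u, v) \<in> adj_rel E ^^ gdist E u v"
proof -
  have "(u, v) \<in> (adj_rel E)\<^sup>*" using connected assms by (auto simp: connected_graph_def)
  then have "\<exists>n. (u, v) \<in> adj_rel E ^^ n" by (simp add: rtrancl_power)
  then show ?thesis unfolding gdist_def by (rule LeastI_ex)
qed

lemma gdist_le: "(u, v) \<in> adj_rel E ^^ n \<Longrightarrow> gdist E u v \<le> n"
  unfolding gdist_def by (rule Least_le)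

lemma gdist_self: "gdist E u u = 0"
  using gdist_le[of u u 0] by simp

lemma gdist_0:
  assumes "u \<in> V" "v \<in> V" "gdist E u v = 0" shows "v = u"
  using gdist_walk[OF assms(1,2)] assms(3) by simp

lemma walk_parity:
  assumes "(u, v) \<in> adj_rel E ^^ n" "u \<in> V" "v \<in> V"
  shows "even n \<longleftrightarrow> (u \<in> A \<longleftrightarrow> v \<in> A)"
  using assms(1,3)
proof (induction n arbitrary: v)
  case (Suc n)
  then obtain w where w: "(u, w) \<in> adj_rel E ^^ n" "{w, v} \<in> E"
    by (auto simp: adj_rel_iff)
  then have "w \<in> V" using edge_subset by auto
  moreover have "w \<in> A \<longleftrightarrow> v \<notin> A"
    by (rule edge_cases[OF w(2)]) (use AB in \<open>auto simp: doubleton_eq_iff\<close>)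
  ultimately show ?case using Suc.IH w(1) by auto
qed simp

lemma gdist_parity:
  assumes "u \<in> V" "v \<in> V" shows "even (gdist E u v) \<longleftrightarrow> (u \<in> A \<longleftrightarrow> v \<in> A)"
  using walk_parity[OF gdist_walk] assms by blast

lemma gdist_step_le:
  assumes "u \<in> V" "{v, w} \<in> E" shows "gdist E u w \<le> Suc (gdist E u v)"
proof -
  have "v \<in> V" using assms(2) edge_subset by auto
  then have "(u, w) \<in> adj_rel E ^^ Suc (gdist E u v)"
    using relpow_Suc_I[OF gdist_walk[OF assms(1)], of v w] assms(2) by (simp add: adj_rel_iff)
  then show ?thesis by (rule gdist_le)
qed

lemma gdist_step:
  assumes "u \<in> V" "{v, w} \<in> E"
  shows "gdist E u w = Suc (gdist E u v) \<or> gdist E u v = Suc (gdist E u w)"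
proof -
  have vw: "v \<in> V" "w \<in> V" using assms(2) edge_subset by auto
  have "w \<in> A \<longleftrightarrow> v \<notin> A"
    by (rule edge_cases[OF assms(2)]) (use AB in \<open>auto simp: doubleton_eq_iff\<close>)
  then have "gdist E u v \<noteq> gdist E u w"
    using gdist_parity[OF assms(1) vw(1)] gdist_parity[OF assms(1) vw(2)] by auto
  moreover have "gdist E u w \<le> Suc (gdist E u v)" using gdist_step_le[OF assms] .
  moreover have "gdist E u v \<le> Suc (gdist E u w)"
    using gdist_step_le[OF assms(1), of w v] assms(2) by (simp add: insert_commute)
  ultimately show ?thesis by linarith
qed

lemma gdist_pred:
  assumes "u \<in> V" "v \<in> V" "gdist E u v = Suc j"
  obtains w where "{w, v} \<in> E" "gdist E u w = j"
proof -
  obtain w where w: "(u, w) \<in> adj_rel E ^^ j" "{w, v} \<in> E"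
    using gdist_walk[OF assms(1,2)] unfolding assms(3) by (auto simp: adj_rel_iff)
  have "gdist E u w \<le> j" using gdist_le[OF w(1)] .
  moreover have "Suc j \<le> Suc (gdist E u w)" using gdist_step_le[OF assms(1) w(2)] assms(3) by simp
  ultimately show ?thesis using that w by auto
qed

text \<open>Descend from both vertices towards \<open>u\<close>, one level at a time, until the two
  descents meet. Meeting at level 0 at the latest leaves at most \<open>2 j + 1\<close>
  vertices.\<close>

lemma path_through_ball:
  assumes "u \<in> V" "w\<^sub>1 \<in> V" "w\<^sub>2 \<in> V" "w\<^sub>1 \<noteq> w\<^sub>2" "gdist E u w\<^sub>1 = j" "gdist E u w\<^sub>2 = j"
  shows "\<exists>p. p \<noteq> [] \<and> hd p = w\<^sub>1 \<and> last p = w\<^sub>2 \<and> distinct p \<and> successively (\<lambda>x y. {x, y} \<in> E) p \<and>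
    length p \<le> 2 * j + 1 \<and> (\<forall>x\<in>set p. gdist E u x \<le> j)"
  using assms(2-)
proof (induction j arbitrary: w\<^sub>1 w\<^sub>2)
  case 0
  then show ?case using gdist_0 assms(1) by metis
next
  case (Suc j)
  obtain p\<^sub>1 where p1: "{p\<^sub>1, w\<^sub>1} \<in> E" "gdist E u p\<^sub>1 = j"
    using gdist_pred[OF assms(1)] Suc.prems by metis
  obtain p\<^sub>2 where p2: "{p\<^sub>2, w\<^sub>2} \<in> E" "gdist E u p\<^sub>2 = j"
    using gdist_pred[OF assms(1)] Suc.prems by metis
  have V: "p\<^sub>1 \<in> V" "p\<^sub>2 \<in> V" using p1 p2 edge_subset by auto
  have sw: "{w\<^sub>1, p\<^sub>1} \<in> E" using p1(1) by (simp add: insert_commute)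
  show ?case
  proof (cases "p\<^sub>1 = p\<^sub>2")
    case True
    have "w\<^sub>1 \<noteq> p\<^sub>1" "w\<^sub>2 \<noteq> p\<^sub>1" using Suc.prems(4,5) p1(2) by auto
    then show ?thesis using True p1 p2 sw Suc.prems
      by (intro exI[of _ "[w\<^sub>1, p\<^sub>1, w\<^sub>2]"]) auto
  next
    case False
    then obtain p where p: "p \<noteq> []" "hd p = p\<^sub>1" "last p = p\<^sub>2" "distinct p"
      "successively (\<lambda>x y. {x, y} \<in> E) p" "length p \<le> 2 * j + 1" "\<forall>x\<in>set p. gdist E u x \<le> j"
      using Suc.IH[OF V False p1(2) p2(2)] by blast
    \<comment> \<open>The new ends lie one level above every vertex of \<open>p\<close>.\<close>
    have "w\<^sub>1 \<notin> set p" "w\<^sub>2 \<notin> set p" using p(7) Suc.prems(4,5) by auto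
    then show ?thesis using p p1 p2 sw Suc.prems
      by (intro exI[of _ "w\<^sub>1 # p @ [w\<^sub>2]"])
        (auto simp: successively_Cons successively_append_iff intro: le_SucI)
  qed
qed

text \<open>Two predecessors of \<open>v\<close> are joined by a path inside the ball of radius
  \<open>j\<close>, which \<open>v\<close> closes to a cycle of at most \<open>2 j + 2\<close>
  vertices.\<close>

lemma unique_pred:
  assumes girth: "\<And>c. is_cycle E c \<Longrightarrow> g \<le> length c"
    and "u \<in> V" "{w\<^sub>1, v} \<in> E" "{w\<^sub>2, v} \<in> E" "gdist E u v = Suc j" "gdist E u w\<^sub>1 = j" "gdist E u w\<^sub>2 = j"
    and "2 * j + 2 < g"
  shows "w\<^sub>1 = w\<^sub>2"
proof (rule ccontr)
  assume ne: "w\<^sub>1 \<noteq> w\<^sub>2"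
  have "w\<^sub>1 \<in> V" "w\<^sub>2 \<in> V" using assms(3,4) edge_subset by auto
  then obtain p where p: "p \<noteq> []" "hd p = w\<^sub>1" "last p = w\<^sub>2" "distinct p"
      "successively (\<lambda>x y. {x, y} \<in> E) p" "length p \<le> 2 * j + 1" "\<forall>x\<in>set p. gdist E u x \<le> j"
    using path_through_ball[OF assms(2) _ _ ne assms(6,7)] by blast
  have v: "v \<notin> set p" using p(7) assms(5) by auto
  have "length p \<noteq> 1" using p(1-3) ne by (cases p) auto
  then have len: "2 \<le> length p" using p(1) by (cases p; cases "tl p") auto
  have succ: "successively (\<lambda>x y. {x, y} \<in> E) (v # p)"
    using p assms(3) by (simp add: successively_Cons insert_commute)
  have "is_cycle E (v # p)"
    unfolding is_cycle_def
  proof (intro conjI allI impI)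
    fix i assume i: "i < length (v # p)"
    show "{(v # p) ! i, (v # p) ! (Suc i mod length (v # p))} \<in> E"
    \<comment> \<open>The last position wraps around: its edge leads from \<open>w\<^sub>2\<close>
      back to \<open>v\<close>.\<close>
    proof (cases "i = length p")
      case True
      then have "(v # p) ! i = w\<^sub>2" using p(1,3) by (simp add: last_conv_nth nth_Cons')
      then show ?thesis using True assms(4) by simp
    next
      case False
      then show ?thesis using successively_nth[OF succ, of i] i by auto
    qed
  qed (use p v len in auto)
  then show False using girth[of "v # p"] p(6) assms(8) by simp
qed

section \<open>Edges at a common vertex and the quadratic relations\<close>

definition star :: "'v set \<Rightarrow> 'v set \<Rightarrow> 'v set set" where
  "star D e = {g \<in> E. g \<inter> D = e \<inter> D}"

lemma finite_star: "finite (star D e)"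
  using finite_E by (simp add: star_def)

text \<open>The pair \<open>(D, D')\<close> allows the roles of \<open>A\<close> and
  \<open>B\<close> to be exchanged, as needed when \<open>M\<close> and \<open>N\<close> are applied
  alternately.\<close>

lemma end_in_pair:
  assumes "g \<in> E" "(D, D') \<in> {(A, B), (B, A)}"
  shows "{end_in D g, end_in D' g} = g" "end_in D g \<in> D" "end_in D' g \<in> D'"
proof -
  obtain a b where ab: "a \<in> A" "b \<in> B" "g = {a, b}" "end_in A g = a" "end_in B g = b"
    by (rule edge_cases[OF assms(1)])
  have AB: "{end_in A g, end_in B g} = g \<and> end_in A g \<in> A \<and> end_in B g \<in> B"
    unfolding ab(4,5) using ab(1,2) by (intro conjI) (simp_all only: ab(3))
  then have BA: "{end_in B g, end_in A g} = g \<and> end_in B g \<in> B \<and> end_in A g \<in> A"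
    by (simp only: insert_commute simp_thms)
  from assms(2) have "D = A \<and> D' = B \<or> D = B \<and> D' = A" by simp
  then have h: "{end_in D g, end_in D' g} = g \<and> end_in D g \<in> D \<and> end_in D' g \<in> D'"
    by (elim disjE conjE; hypsubst) (rule AB, rule BA)
  from h[THEN conjunct1] h[THEN conjunct2, THEN conjunct1] h[THEN conjunct2, THEN conjunct2]
  show "{end_in D g, end_in D' g} = g" "end_in D g \<in> D" "end_in D' g \<in> D'" .
qed

lemma doubleton_eqD: "{x, y} = {a, w} \<Longrightarrow> a \<noteq> y \<Longrightarrow> x = a \<and> y = w"
  by (auto simp: doubleton_eq_iff)

lemma end_in_insert:
  assumes "{a, w} \<in> E" "a \<in> D" "(D, D') \<in> {(A, B), (B, A)}"
  shows "end_in D {a, w} = a" "end_in D' {a, w} = w"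
proof -
  have disj: "D \<inter> D' = {}" using assms(3) AB(2) by auto
  note g = end_in_pair[OF assms(1,3)]
  have "a \<noteq> end_in D' {a, w}" using g(3) assms(2) disj by (metis IntI empty_iff)
  from doubleton_eqD[OF g(1) this, THEN conjunct1] doubleton_eqD[OF g(1) this, THEN conjunct2]
  show "end_in D {a, w} = a" "end_in D' {a, w} = w" .
qed

lemma mem_edge_iff:
  assumes "g \<in> E" "a \<in> D" "D \<in> {A, B}" shows "a \<in> g \<longleftrightarrow> end_in D g = a"
proof -
  obtain D' where D': "(D, D') \<in> {(A, B), (B, A)}" using assms(3) by blast
  note g = end_in_pair[OF assms(1) D']
  have "D \<inter> D' = {}" using D' AB(2) by auto
  then have "a \<noteq> end_in D' g" using g(3) assms(2) by blast
  moreover have "a \<in> g \<longleftrightarrow> a = end_in D g \<or> a = end_in D' g"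
    by (subst g(1)[symmetric]) simp
  ultimately show ?thesis by auto
qed

lemma star_eq: "e \<in> E \<Longrightarrow> D \<in> {A, B} \<Longrightarrow> star D e = {g \<in> E. end_in D g = end_in D e}"
  using end_in_eq_iff by (auto simp: star_def)

lemma star_eq_incident:
  assumes "e \<in> E" "D \<in> {A, B}"
  shows "star D e = {g \<in> E. end_in D e \<in> g}"
proof -
  obtain D' where "(D, D') \<in> {(A, B), (B, A)}" using assms(2) by blast
  from end_in_pair(2)[OF assms(1) this] show ?thesis
    unfolding star_eq[OF assms]
    by (intro Collect_cong conj_cong refl mem_edge_iff[symmetric] assms(2))
qed

lemma star_eq_degree:
  "e \<in> E \<Longrightarrow> D \<in> {A, B} \<Longrightarrow> card (star D e) = degree_of E (end_in D e)"
  unfolding degree_of_def by (simp only: star_eq_incident)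

text \<open>The star of \<open>e\<close> contains \<open>e\<close> while the matrix has zero
  diagonal. Hence \<open>1 + M\<close> and \<open>1 + N\<close> are plain sums over stars.\<close>

lemma share_sum:
  assumes "e \<in> E"
  shows "(\<Sum>g\<in>E. share_matrix E D e g * w g) = (\<Sum>g\<in>star D e. w g) - w e"
proof -
  have "(\<Sum>g\<in>E. share_matrix E D e g * w g) = (\<Sum>g\<in>E. if g \<in> star D e - {e} then w g else 0)"
    using assms by (intro sum.cong) (auto simp: share_matrix_def star_def)
  also have "\<dots> = (\<Sum>g\<in>star D e - {e}. w g)"
    using finite_E by (subst sum.inter_restrict[symmetric]) (auto simp: star_def intro!: sum.cong)
  also have "\<dots> = (\<Sum>g\<in>star D e. w g) - w e"
    using assms finite_star by (subst sum_diff1) (auto simp: star_def)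
  finally show ?thesis .
qed

lemma star_self: "e \<in> E \<Longrightarrow> e \<in> star D e"
  unfolding star_def by blast

lemma star_cong: "g \<in> star D e \<Longrightarrow> star D g = star D e"
  unfolding star_def by blast

lemma star_subset: "g \<in> star D e \<Longrightarrow> g \<in> E"
  unfolding star_def by blast

lemma share_matrix_star: "e \<in> E \<Longrightarrow> share_matrix E D e f = (if f \<in> star D e \<and> e \<noteq> f then 1 else 0)"
  unfolding share_matrix_def star_def by (rule if_cong) blast+

lemma share_matrix_outside: "e \<notin> E \<or> f \<notin> E \<Longrightarrow> share_matrix E D e f = 0"
  unfolding share_matrix_def by (rule if_not_P) blast

text \<open>On each star \<open>1 + X\<close> is the all-ones matrix of size \<open>q + 1\<close>,
  so \<open>(1 + X)^2 = (q + 1) (1 + X)\<close>.\<close>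

lemma share_quadratic:
  assumes "\<And>e. e \<in> E \<Longrightarrow> card (star D e) = Suc q"
  shows "cmat_mult E (share_matrix E D) (share_matrix E D) =
    cmat_add (cmat_smult (of_nat q - 1) (share_matrix E D)) (cmat_smult (of_nat q) (cmat_one E))"
proof (intro ext)
  fix e f
  show "cmat_mult E (share_matrix E D) (share_matrix E D) e f =
    cmat_add (cmat_smult (of_nat q - 1) (share_matrix E D)) (cmat_smult (of_nat q) (cmat_one E)) e f"
  proof (cases "e \<in> E")
    case True
    have "(\<Sum>g\<in>star D e. share_matrix E D g f) =
        (\<Sum>g\<in>star D e. if f \<in> star D e then 1 - (if g = f then 1 else 0) else 0)"
      by (intro sum.cong refl) (simp add: share_matrix_star star_subset star_cong)
    also have "\<dots> = (if f \<in> star D e then of_nat q else 0)"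
      using finite_star assms[OF True] by (simp add: sum_subtractf)
    finally have "cmat_mult E (share_matrix E D) (share_matrix E D) e f
        = (if f \<in> star D e then of_nat q else 0) - share_matrix E D e f"
      unfolding cmat_mult_def share_sum[OF True] by simp
    then show ?thesis
      using True star_self[OF True, of D]
      by (cases "e = f") (simp_all add: cmat_add_def cmat_smult_def cmat_one_def share_matrix_star)
  next
    case False
    then show ?thesis
      by (simp add: cmat_mult_def cmat_add_def cmat_smult_def cmat_one_def share_matrix_def)
  qed
qed

end

section \<open>The long relation from girth deficiency two\<close>

locale girth_deficiency_two = bipartite_graph V E A B
  for V :: "'v set" and E :: "'v set set" and A B :: "'v set" +
  fixes k l r :: nat
  assumes degree_A: "a \<in> A \<Longrightarrow> degree_of E a = Suc k"
    and degree_B: "b \<in> B \<Longrightarrow> degree_of E b = Suc l"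
    and ecc_B: "b \<in> B \<Longrightarrow> v \<in> V \<Longrightarrow> gdist E b v \<le> 2 * r + 1"
    and far_A: "\<exists>a\<in>A. \<exists>a'\<in>A. gdist E a a' = 2 * r + 2"
    and girth_ge: "is_cycle E c \<Longrightarrow> 4 * r + 2 \<le> length c"
    and girth_cycle: "\<exists>c. is_cycle E c \<and> length c = 4 * r + 2"
    and r_pos: "r \<ge> 1"
begin

abbreviation "M \<equiv> share_matrix E A"
abbreviation "N \<equiv> share_matrix E B"

lemma card_star_A: "e \<in> E \<Longrightarrow> card (star A e) = Suc k"
  using star_eq_degree[of e A] degree_A[OF end_in_pair(2)[of e A B]] by simp

lemma card_star_B: "e \<in> E \<Longrightarrow> card (star B e) = Suc l"
  using star_eq_degree[of e B] degree_B[OF end_in_pair(2)[of e B A]] by simp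

text \<open>The products \<open>(N M)^i (1 + N)\<close> of the long relation. Multiplying from the
  left lets each step act on the columns, which are functions on the edges.\<close>

fun W :: "nat \<Rightarrow> 'v set cmat" where
  "W 0 = cmat_add (cmat_one E) N"
| "W (Suc i) = cmat_mult E N (cmat_mult E M (W i))"

text \<open>Up to distance \<open>2 * r\<close> the graph is a tree around the vertex of \<open>f\<close> in \<open>B\<close>, so that
  alternating products of \<open>M\<close> and \<open>N\<close> share_matrix_pushes_outwards the edges leaving a sphere one step outwards.\<close>

lemma share_matrix_pushes_outwards:
  assumes D: "(D, D') \<in> {(A, B), (B, A)}" and e: "e \<in> E" and b: "b \<in> V" and j: "Suc j \<le> 2 * r"
  defines "d \<equiv> gdist E b"
  shows "(\<Sum>g\<in>E. share_matrix E D e g * (if d (end_in D' g) = j \<and> d (end_in D g) = Suc j then 1 else 0))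
    = (if d (end_in D e) = Suc j \<and> d (end_in D' e) = Suc (Suc j) then 1 else 0)"
    (is "(\<Sum>g\<in>E. _ * ?X g) = _")
proof -
  have DAB: "D \<in> {A, B}" using D by auto
  note e' = end_in_pair[OF e D]
  have sum: "(\<Sum>g\<in>E. share_matrix E D e g * ?X g) = (\<Sum>g\<in>star D e. ?X g) - ?X e"
    by (rule share_sum[OF e])
  show ?thesis
  proof (cases "d (end_in D e) = Suc j")
    case False
    then have "(\<Sum>g\<in>star D e. ?X g) = 0"
      by (intro sum.neutral ballI) (simp add: star_eq[OF e DAB])
    with False show ?thesis unfolding sum by simp
  next
    case True
    have aV: "end_in D e \<in> V" using e'(1) edge_subset[OF e] by (metis insert_subset)
    obtain w where w: "{w, end_in D e} \<in> E" "d w = j"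
      using gdist_pred[OF b aV] True unfolding d_def by metis
    define g\<^sub>0 where "g\<^sub>0 = {end_in D e, w}"
    have g0: "g\<^sub>0 \<in> E" "end_in D g\<^sub>0 = end_in D e" "end_in D' g\<^sub>0 = w"
      using w(1) end_in_insert[OF _ e'(2) D] unfolding g\<^sub>0_def by (auto simp: insert_commute)
    have "(\<Sum>g\<in>star D e. ?X g) = (\<Sum>g\<in>star D e. if g = g\<^sub>0 then 1 else 0)"
    proof (intro sum.cong refl)
      fix g assume "g \<in> star D e"
      then have g: "g \<in> E" "end_in D g = end_in D e" using star_eq[OF e DAB] by auto
      have gp: "{end_in D g, end_in D' g} = g" by (rule end_in_pair(1)[OF g(1) D])
      have "g = g\<^sub>0" if "d (end_in D' g) = j"
      proof -
        have "{end_in D' g, end_in D e} \<in> E" using gp g by (metis insert_commute)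
        \<comment> \<open>The cycle closed by a second predecessor would have at most
          \<open>2 j + 2 \<le> 4 r\<close> vertices, fewer than the girth.\<close>
        then have "end_in D' g = w"
          using unique_pred[OF girth_ge b _ w(1), of "end_in D' g" j] True w(2) that j
          unfolding d_def by simp
        then show ?thesis using gp g(2) unfolding g\<^sub>0_def by simp
      qed
      then have far: "d (end_in D' g) \<noteq> j" if "g \<noteq> g\<^sub>0" using that by blast
      show "?X g = (if g = g\<^sub>0 then 1 else 0)"
      proof (cases "g = g\<^sub>0")
        case True
        then show ?thesis using \<open>d (end_in D e) = Suc j\<close> by (simp add: g0 w(2))
      next
        case False
        then show ?thesis using far by simp
      qed
    qed
    also have "g\<^sub>0 \<in> star D e" unfolding star_eq[OF e DAB] using g0 by simp
    then have "(\<Sum>g\<in>star D e. if g = g\<^sub>0 then 1 else 0) = (1 :: complex)"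
      using finite_star by simp
    finally have 1: "(\<Sum>g\<in>star D e. ?X g) = 1" .
    have "{end_in D e, end_in D' e} \<in> E" using e'(1) e by simp
    then have "d (end_in D' e) = Suc (Suc j) \<or> d (end_in D' e) = j"
      using gdist_step[OF b, of "end_in D e" "end_in D' e"] True unfolding d_def by linarith
    \<comment> \<open>Exactly one edge of the star points inwards. Subtracting \<open>?X e\<close>
      cancels it if it is \<open>e\<close> itself; for an outward \<open>e\<close> the value 1
      remains.\<close>
    then show ?thesis unfolding sum 1 True by (elim disjE) simp_all
  qed
qed

lemma W_outside: "e \<notin> E \<or> f \<notin> E \<Longrightarrow> W i e f = 0"
  by (induction i arbitrary: e)
    (auto simp: cmat_add_def cmat_one_def share_matrix_outside cmat_mult_def intro!: sum.neutral)

text \<open>The column of \<open>1 + N\<close> at \<open>f\<close> is the star of its vertex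
  \<open>b\<close> in \<open>B\<close>, that is, the edges leaving the sphere of radius 0. Each pair
  \<open>N M\<close> pushes them two levels outwards, and \<open>i \<le> r\<close> keeps the process
  inside the tree around \<open>b\<close>.\<close>

lemma W_entry:
  assumes "e \<in> E" "f \<in> E" "i \<le> r"
  defines "d \<equiv> gdist E (end_in B f)"
  shows "W i e f = (if d (end_in B e) = 2 * i \<and> d (end_in A e) = Suc (2 * i) then 1 else 0)"
  using assms(1,3)
proof (induction i arbitrary: e)
  case 0
  have V: "end_in B f \<in> V" "end_in B e \<in> V"
    using end_in_pair(3)[OF assms(2), of A B] end_in_pair(3)[OF 0(1), of A B] AB(1) by auto
  have "{end_in B e, end_in A e} \<in> E" using end_in_pair(1)[OF 0(1), of B A] 0(1) by simp
  then have "d (end_in B e) = 0 \<Longrightarrow> d (end_in A e) = 1"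
    using gdist_step[OF V(1)] unfolding d_def by fastforce
  moreover have "d (end_in B e) = 0 \<longleftrightarrow> end_in B e = end_in B f"
    using gdist_0[OF V] gdist_self unfolding d_def by metis
  moreover have "W 0 e f = (if end_in B e = end_in B f then 1 else 0)"
    using 0(1) assms(2)
    by (cases "e = f") (auto simp: cmat_add_def cmat_one_def share_matrix_star star_eq)
  ultimately show ?case by auto
next
  case (Suc i)
  have b: "end_in B f \<in> V" using end_in_pair(3)[OF assms(2), of A B] AB(1) by auto
  have "W (Suc i) e f = (\<Sum>g\<in>E. N e g * (\<Sum>h\<in>E. M g h * W i h f))"
    by (simp add: cmat_mult_def)
  also have "\<dots> = (\<Sum>g\<in>E. N e g * (\<Sum>h\<in>E. M g h *
      (if d (end_in B h) = 2 * i \<and> d (end_in A h) = Suc (2 * i) then 1 else 0)))"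
    using Suc by (intro sum.cong arg_cong2[where f = "(*)"] refl) simp
  also have "\<dots> = (\<Sum>g\<in>E. N e g *
      (if d (end_in A g) = Suc (2 * i) \<and> d (end_in B g) = Suc (Suc (2 * i)) then 1 else 0))"
    using Suc.prems(2) share_matrix_pushes_outwards[of A B _ "end_in B f" "2 * i"] b unfolding d_def
    by (intro sum.cong refl) simp
  also have "\<dots> = (if d (end_in B e) = Suc (Suc (2 * i)) \<and> d (end_in A e) = Suc (Suc (Suc (2 * i))) then 1 else 0)"
    using Suc.prems share_matrix_pushes_outwards[of B A e "end_in B f" "Suc (2 * i)"] b unfolding d_def by simp
  finally show ?case by simp
qed

text \<open>The edges from level \<open>2 r\<close> to level \<open>2 r + 1\<close> around a vertex
  of \<open>B\<close> are all the edges at the vertices of level \<open>2 r + 1\<close>, as no level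
  follows. Hence the columns of \<open>W r\<close> are constant on stars at \<open>A\<close>, and
  \<open>1 + M\<close> multiplies them by \<open>k + 1\<close>.\<close>

lemma M_W: "cmat_mult E M (W r) = cmat_smult (of_nat k) (W r)"
proof (intro ext)
  fix e f
  show "cmat_mult E M (W r) e f = cmat_smult (of_nat k) (W r) e f"
  proof (cases "e \<in> E \<and> f \<in> E")
    case False
    then show ?thesis
      using W_outside by (auto simp: cmat_mult_def cmat_smult_def share_matrix_outside intro!: sum.neutral)
  next
    case True
    let ?d = "gdist E (end_in B f)"
    have b: "end_in B f \<in> B" "end_in B f \<in> V" using end_in_pair(3)[of f A B] True AB(1) by auto
    have *: "W r g f = (if ?d (end_in A e) = Suc (2 * r) then 1 else 0)" if "g \<in> star A e" for g
    proof -
      have g: "g \<in> E" "end_in A g = end_in A e" using that True star_eq by auto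
      then have "{end_in A e, end_in B g} \<in> E" using end_in_pair(1)[OF g(1), of A B] by simp
      moreover have "?d (end_in B g) \<le> 2 * r + 1"
        using ecc_B[OF b(1)] end_in_pair(3)[OF g(1), of A B] AB(1) by auto
      \<comment> \<open>The alternative \<open>2 r + 2\<close> exceeds the eccentricity bound on
        \<open>B\<close>.\<close>
      ultimately have "?d (end_in A e) = Suc (2 * r) \<Longrightarrow> ?d (end_in B g) = 2 * r"
        using gdist_step[OF b(2), of "end_in A e" "end_in B g"] by auto
      then show ?thesis using W_entry[OF g(1), of f r] True g(2) by auto
    qed
    have e: "W r e f = (if ?d (end_in A e) = Suc (2 * r) then 1 else 0)"
      by (rule *) (use True star_self in blast)
    have "cmat_mult E M (W r) e f = (\<Sum>g\<in>star A e. W r g f) - W r e f"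
      unfolding cmat_mult_def by (rule share_sum) (use True in simp)
    also have "\<dots> = of_nat k * W r e f"
      using card_star_A[of e] True by (simp add: * e)
    finally show ?thesis by (simp add: cmat_smult_def)
  qed
qed

section \<open>Consequences of a cycle of length \<open>4 r + 2\<close>\<close>

lemma cycle_degree:
  assumes c: "is_cycle E c" and i: "Suc (Suc i) < length c"
  shows "2 \<le> degree_of E (c ! Suc i)"
proof -
  have E: "{c ! j, c ! (Suc j mod length c)} \<in> E" if "j < length c" for j
    using c that unfolding is_cycle_def by blast
  have dist: "distinct c" using c unfolding is_cycle_def by blast
  have "{c ! i, c ! Suc i} \<in> E"
    using E[of i] i by (simp only: mod_less Suc_lessD)
  moreover have "{c ! Suc i, c ! Suc (Suc i)} \<in> E"
    using E[of "Suc i"] i by (simp only: mod_less Suc_lessD)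
  ultimately have sub: "{{c ! i, c ! Suc i}, {c ! Suc i, c ! Suc (Suc i)}} \<subseteq> {e \<in> E. c ! Suc i \<in> e}"
    by blast
  have "c ! i \<noteq> c ! Suc (Suc i)" "c ! i \<noteq> c ! Suc i"
    using dist i by (simp_all add: nth_eq_iff_index_eq)
  then have "{c ! i, c ! Suc i} \<noteq> {c ! Suc i, c ! Suc (Suc i)}"
    by (simp add: doubleton_eq_iff)
  then have "card {{c ! i, c ! Suc i}, {c ! Suc i, c ! Suc (Suc i)}} = 2" by simp
  moreover have "finite {e \<in> E. c ! Suc i \<in> e}" using finite_E by simp
  ultimately show ?thesis
    unfolding degree_of_def using card_mono[OF _ sub] by linarith
qed

text \<open>Two consecutive vertices of the cycle lie in different classes, and each has two cycle
  edges. Positivity of \<open>k l\<close> makes the roots of \<open>F_r\<close> real and simple;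
  \<open>l > 0\<close> makes \<open>z\<close> nonzero.\<close>

lemma k_pos: "k > 0" and l_pos: "l > 0"
proof -
  obtain c where c: "is_cycle E c" "length c = 4 * r + 2" using girth_cycle by blast
  have "Suc (Suc (Suc 0)) < length c" using c(2) r_pos by simp
  note deg = cycle_degree[OF c(1) Suc_lessD[OF this]] cycle_degree[OF c(1) this]
  have "\<forall>i<length c. {c ! i, c ! (Suc i mod length c)} \<in> E"
    using c(1) unfolding is_cycle_def by blast
  then have "{c ! Suc 0, c ! (Suc (Suc 0) mod length c)} \<in> E"
    using \<open>Suc (Suc (Suc 0)) < length c\<close> Suc_lessD by blast
  then have "{c ! Suc 0, c ! Suc (Suc 0)} \<in> E"
    using \<open>Suc (Suc (Suc 0)) < length c\<close> by (simp only: mod_less Suc_lessD)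
  then obtain a b where "a \<in> A" "b \<in> B" "{c ! Suc 0, c ! Suc (Suc 0)} = {a, b}" by (rule edge_cases)
  then have "2 \<le> degree_of E a" "2 \<le> degree_of E b"
    using deg by (auto simp: doubleton_eq_iff)
  then show "k > 0" "l > 0" using degree_A[OF \<open>a \<in> A\<close>] degree_B[OF \<open>b \<in> B\<close>] by simp_all
qed

text \<open>Cyclic telescoping; evenness of \<open>n\<close> gives the wrap-around term
  \<open>f 0\<close> the sign opposite to that of the first term.\<close>

lemma alternating_sum_cancel:
  fixes f :: "nat \<Rightarrow> complex"
  assumes "even n" "n > 0"
  shows "(\<Sum>i<n. (- 1) ^ i * (f i + f (Suc i mod n))) = 0"
proof -
  obtain m where m: "n = Suc m" using assms(2) by (cases n) auto
  have "(\<Sum>i<n. (- 1) ^ i * f (Suc i mod n)) = (\<Sum>i<m. (- 1) ^ i * f (Suc i)) + (- 1) ^ m * f 0"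
    unfolding m by simp
  moreover have "(\<Sum>i<n. (- 1) ^ i * f i) = f 0 - (\<Sum>i<m. (- 1) ^ i * f (Suc i))"
    unfolding m sum.lessThan_Suc_shift by (simp add: sum_negf)
  moreover have "(- 1) ^ m = (- 1 :: complex)" using assms(1) unfolding m by simp
  ultimately show ?thesis by (simp add: distrib_left sum.distrib)
qed

text \<open>Signs alternate along a cycle of even length, so that the two cycle edges at each vertex
  cancel. Written as a sum over positions, \<open>w\<close> can be summed around a vertex position
  by position.\<close>

lemma alternating_function:
  "\<exists>w :: 'v set \<Rightarrow> complex. (\<forall>e. e \<notin> E \<longrightarrow> w e = 0) \<and> w \<noteq> (\<lambda>_. 0) \<and>
    (\<forall>v. (\<Sum>g\<in>{g \<in> E. v \<in> g}. w g) = 0)"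
proof -
  obtain c where c: "is_cycle E c" "length c = 4 * r + 2" using girth_cycle by blast
  let ?n = "length c"
  define g where "g i = {c ! i, c ! (Suc i mod ?n)}" for i
  have n: "?n \<ge> 6" using c(2) r_pos by simp
  have gE: "g i \<in> E" if "i < ?n" for i
    using c(1) that unfolding is_cycle_def g_def by blast
  have dist: "distinct c" using c(1) unfolding is_cycle_def by blast
  define w :: "'v set \<Rightarrow> complex" where "w e = (\<Sum>i<?n. if e = g i then (- 1) ^ i else 0)" for e
  have "w e = 0" if "e \<notin> E" for e
    unfolding w_def using gE that by (intro sum.neutral) auto
  moreover have "w (g 0) = 1"
  proof -
    \<comment> \<open>The edge at position 0 occurs only once: a second position \<open>i\<close>
      would satisfy \<open>Suc i mod ?n = 0\<close> and \<open>i = 1\<close>, forcing length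
      2.\<close>
    have "i = 0" if "g 0 = g i" "i < ?n" for i
    proof (rule ccontr)
      assume "i \<noteq> 0"
      have lt: "Suc 0 mod ?n < ?n" "Suc i mod ?n < ?n" "0 < ?n"
        using n by (auto intro!: mod_less_divisor)
      have "c ! 0 = c ! (Suc i mod ?n) \<and> c ! (Suc 0 mod ?n) = c ! i \<or> c ! 0 = c ! i"
        using that(1) unfolding g_def doubleton_eq_iff by auto
      then have "0 = Suc i mod ?n \<and> Suc 0 mod ?n = i"
        using \<open>i \<noteq> 0\<close> that(2) lt dist by (auto simp: nth_eq_iff_index_eq)
      then show False using n by (cases "Suc i < ?n") auto
    qed
    then have "w (g 0) = (\<Sum>i<?n. if i = 0 then 1 else 0)"
      unfolding w_def by (intro sum.cong refl) auto
    moreover have "c \<noteq> []" using n by (cases c) simp_all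
    ultimately show ?thesis by simp
  qed
  moreover have "(\<Sum>e\<in>{e \<in> E. v \<in> e}. w e) = 0" for v
  proof -
    let ?f = "\<lambda>i. if v = c ! i then 1 else 0 :: complex"
    have "(\<Sum>e\<in>{e \<in> E. v \<in> e}. w e) = (\<Sum>i<?n. \<Sum>e\<in>{e \<in> E. v \<in> e}. if e = g i then (- 1) ^ i else 0)"
      unfolding w_def by (rule sum.swap)
    \<comment> \<open>An edge of the cycle counts at \<open>v\<close> once if \<open>v\<close> is
      one of its two distinct ends, so membership is the sum of two indicators.\<close>
    also have "\<dots> = (\<Sum>i<?n. (- 1) ^ i * (?f i + ?f (Suc i mod ?n)))"
    proof (intro sum.cong refl)
      fix i assume "i \<in> {..<?n}"
      then have i: "i < ?n" by simp
      have "Suc i mod ?n < ?n" "Suc i mod ?n \<noteq> i" using n i by (auto simp: mod_Suc)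
      then have "c ! i \<noteq> c ! (Suc i mod ?n)" using dist i by (simp add: nth_eq_iff_index_eq)
      moreover have "v \<in> g i \<longleftrightarrow> v = c ! i \<or> v = c ! (Suc i mod ?n)" by (auto simp: g_def)
      moreover have "(\<Sum>e\<in>{e \<in> E. v \<in> e}. if e = g i then (- 1) ^ i else 0) = (if v \<in> g i then (- 1) ^ i else 0 :: complex)"
        using finite_E gE[OF i] by simp
      ultimately show "(\<Sum>e\<in>{e \<in> E. v \<in> e}. if e = g i then (- 1) ^ i else 0) = (- 1) ^ i * (?f i + ?f (Suc i mod ?n))"
        by auto
    qed
    also have "\<dots> = 0" using c(2) by (intro alternating_sum_cancel) auto
    finally show ?thesis .
  qed
  ultimately show ?thesis by (intro exI[of _ w]) auto
qed

lemma far_edges: "\<exists>e\<in>E. \<exists>f\<in>E. gdist E (end_in A f) (end_in A e) = 2 * r + 2"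
proof -
  obtain a a' where aa: "a \<in> A" "a' \<in> A" "gdist E a a' = 2 * r + 2" using far_A by blast
  have "\<exists>e\<in>E. end_in A e = x" if "x \<in> A" for x
  proof -
    have "{e \<in> E. x \<in> e} \<noteq> {}" using degree_A[OF that] unfolding degree_of_def by (metis card.empty nat.simps(3))
    then obtain e where "e \<in> E" "x \<in> e" by blast
    then show ?thesis using mem_edge_iff[of e x A] that by auto
  qed
  then show ?thesis using aa by metis
qed

end

section \<open>Representations of generated algebras\<close>

lemma linearI_explicit:
  assumes "vector_space s" "vector_space s'" "\<And>u v. f (u + v) = f u + f v" "\<And>c u. f (s c u) = s' c (f u)"
  shows "Vector_Spaces.linear s s' f"
  using assms by (simp add: Vector_Spaces.linear_def module_hom_def module_hom_axioms_def module_iff_vector_space)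

lemma linearD_explicit:
  assumes "Vector_Spaces.linear s s' f"
  shows "f (u + v) = f u + f v" "f (s c u) = s' c (f u)"
  using assms by (simp_all add: Vector_Spaces.linear_def module_hom_def module_hom_axioms_def)

lemma representationD:
  assumes "representation E \<A> s \<rho>"
  shows "vector_space s"
    and "\<rho> (cmat_one E) u = u"
    and "a \<in> \<A> \<Longrightarrow> Vector_Spaces.linear s s (\<rho> a)"
    and "a \<in> \<A> \<Longrightarrow> b \<in> \<A> \<Longrightarrow> \<rho> (cmat_add a b) u = \<rho> a u + \<rho> b u"
    and "a \<in> \<A> \<Longrightarrow> \<rho> (cmat_smult c a) u = s c (\<rho> a u)"
    and "a \<in> \<A> \<Longrightarrow> b \<in> \<A> \<Longrightarrow> \<rho> (cmat_mult E a b) u = \<rho> a (\<rho> b u)"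
  using assms by (simp_all add: representation_def)

lemma intertwiner_on_generated_algebra:
  assumes rep: "representation E (generated_algebra E S) s \<rho>"
    and rep': "representation E (generated_algebra E S) s' \<rho>'"
    and lin: "Vector_Spaces.linear s s' \<phi>"
    and gens: "\<And>a u. a \<in> S \<Longrightarrow> \<phi> (\<rho> a u) = \<rho>' a (\<phi> u)"
    and a: "a \<in> generated_algebra E S"
  shows "\<phi> (\<rho> a u) = \<rho>' a (\<phi> u)"
  using a
  by (induction arbitrary: u)
    (simp_all add: representationD[OF rep] representationD[OF rep'] gens linearD_explicit[OF lin])

lemma invariant_under_generated_algebra:
  assumes rep: "representation E (generated_algebra E S) s \<rho>"
    and W: "module.subspace s W"
    and gens: "\<And>a. a \<in> S \<Longrightarrow> \<rho> a ` W \<subseteq> W"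
    and a: "a \<in> generated_algebra E S"
  shows "\<rho> a ` W \<subseteq> W"
proof -
  interpret vector_space s by (rule representationD(1)[OF rep])
  have "\<rho> a u \<in> W" if "u \<in> W" for u
    using a that
    by (induction arbitrary: u)
      (use gens in \<open>auto simp: representationD[OF rep] intro: subspace_add[OF W] subspace_scale[OF W]\<close>)
  then show ?thesis by blast
qed

text \<open>Values prescribed on \<open>M\<close> and \<open>N\<close> need not extend to the
  generated algebra. They do when the model embeds into a representation compatibly with both
  generators: the range is invariant, and the action is pulled back along
  \<open>\<phi>\<close>.\<close>

lemma subrepresentation:
  assumes rep: "representation E (generated_algebra E {M, N}) s \<rho>"
    and vs: "vector_space s'" and lin: "Vector_Spaces.linear s' s \<phi>" and inj: "inj \<phi>"
    and M: "\<And>u. \<rho> M (\<phi> u) = \<phi> (m u)" and N: "\<And>u. \<rho> N (\<phi> u) = \<phi> (n u)"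
  shows "\<exists>\<rho>'. representation E (generated_algebra E {M, N}) s' \<rho>' \<and> \<rho>' M = m \<and> \<rho>' N = n"
proof -
  let ?A = "generated_algebra E {M, N}"
  interpret s: vector_space s by (rule representationD(1)[OF rep])
  interpret \<phi>: Vector_Spaces.linear s' s \<phi> by (rule lin)
  define \<rho>' where "\<rho>' a = (\<lambda>u. inv \<phi> (\<rho> a (\<phi> u)))" for a
  have sub: "s.subspace (range \<phi>)" by (simp add: \<phi>.subspace_image \<phi>.vs1.subspace_UNIV)
  have "\<rho> a ` range \<phi> \<subseteq> range \<phi>" if "a \<in> ?A" for a
    by (rule invariant_under_generated_algebra[OF rep sub _ that]) (use M N in auto)
  then have \<phi>': "\<phi> (\<rho>' a u) = \<rho> a (\<phi> u)" if "a \<in> ?A" for a u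
    unfolding \<rho>'_def using that by (intro f_inv_into_f) blast
  have eqI: "u = v" if "\<phi> u = \<phi> v" for u v using inj that by (rule injD)
  have "representation E ?A s' \<rho>'"
    unfolding representation_def
  proof (intro conjI ballI allI)
    show "vector_space s'" by (rule vs)
    show "Vector_Spaces.linear s' s' (\<rho>' a)" if "a \<in> ?A" for a
      by (intro linearI_explicit vs; rule eqI)
        (simp_all add: \<phi>' that \<phi>.add \<phi>.scale linearD_explicit[OF representationD(3)[OF rep that]])
    show "\<rho>' (cmat_one E) = id"
      by (intro ext; rule eqI) (simp add: \<phi>' generated_algebra.one representationD[OF rep])
    show "\<rho>' (cmat_add a b) = (\<lambda>u. \<rho>' a u + \<rho>' b u)" if "a \<in> ?A" "b \<in> ?A" for a b
      by (intro ext; rule eqI) (simp add: \<phi>' generated_algebra.add that representationD[OF rep] \<phi>.add)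
    show "\<rho>' (cmat_smult c a) = (\<lambda>u. s' c (\<rho>' a u))" if "a \<in> ?A" for c a
      by (intro ext; rule eqI) (simp add: \<phi>' generated_algebra.smult that representationD[OF rep] \<phi>.scale)
    show "\<rho>' (cmat_mult E a b) = \<rho>' a \<circ> \<rho>' b" if "a \<in> ?A" "b \<in> ?A" for a b
      by (intro ext; rule eqI) (simp add: \<phi>' generated_algebra.mult that representationD[OF rep])
  qed
  moreover have "\<rho>' M = m" "\<rho>' N = n"
    by (intro ext; rule eqI; simp add: \<phi>' generated_algebra.gen M N)+
  ultimately show ?thesis by blast
qed

definition fscale :: "complex \<Rightarrow> ('e \<Rightarrow> complex) \<Rightarrow> 'e \<Rightarrow> complex" where
  "fscale c w = (\<lambda>e. c * w e)"

lemma vector_space_fscale: "vector_space fscale"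
  by unfold_locales (auto simp: fscale_def algebra_simps)

lemma irreducible_one_dim:
  assumes "representation E \<A> (*) (\<rho> :: 'e cmat \<Rightarrow> complex \<Rightarrow> complex)"
  shows "irreducible_rep E \<A> (*) \<rho>"
proof -
  have "W = {0} \<or> W = UNIV" if W: "vector_space_over_itself.subspace W" for W
  proof (cases "\<exists>x\<in>W. x \<noteq> 0")
    case True
    then obtain x where x: "x \<in> W" "x \<noteq> 0" by blast
    have "y \<in> W" for y
      using vector_space_over_itself.subspace_scale[OF W x(1), of "y / x"] x(2) by simp
    then show ?thesis by blast
  next
    case False
    then show ?thesis using vector_space_over_itself.subspace_0[OF W] by blast
  qed
  moreover have "(UNIV :: complex set) \<noteq> {0}" by (metis UNIV_I singletonD zero_neq_one)
  ultimately show ?thesis using assms unfolding irreducible_rep_def by blast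
qed

lemma rho2_M_mult: "rho2_M k *v u = vector [of_nat k * u $ 1, - u $ 2]"
  by (simp add: rho2_M_def matrix_vector_mult_def sum_2 vec_eq_iff forall_2)

lemma rho2_N_mult:
  "rho2_N k l t z *v u = vector
    [(t + of_nat l - 1) / (of_nat k + 1) * u $ 1 + z * u $ 2,
     z * u $ 1 + (of_nat k * of_nat l - of_nat k - t) / (of_nat k + 1) * u $ 2]"
  by (simp add: rho2_N_def Let_def matrix_vector_mult_def sum_2 vec_eq_iff forall_2)

text \<open>\<open>1 + M\<close> maps a vector to \<open>k + 1\<close> times its first component, so
  an invariant subspace with a nonzero vector contains a basis vector. The off-diagonal entry
  \<open>z \<noteq> 0\<close> of \<open>N\<close> then produces the other one.\<close>

lemma irreducible_two_dim:
  assumes rep: "representation E \<A> (*s) (\<sigma> :: 'e cmat \<Rightarrow> complex^2 \<Rightarrow> complex^2)"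
    and MN: "M \<in> \<A>" "N \<in> \<A>" "\<sigma> M = (*v) (rho2_M k)" "\<sigma> N = (*v) (rho2_N k l t z)"
    and "z \<noteq> 0"
  shows "irreducible_rep E \<A> (*s) \<sigma>"
proof -
  have "W = {0} \<or> W = UNIV" if W: "vec.subspace W" and inv: "\<forall>a\<in>\<A>. \<sigma> a ` W \<subseteq> W" for W
  proof (cases "\<exists>u\<in>W. u \<noteq> 0")
    case True
    then obtain u where u: "u \<in> W" "u \<noteq> 0" by blast
    have M: "rho2_M k *v w \<in> W" and N: "rho2_N k l t z *v w \<in> W" if "w \<in> W" for w
      using inv MN that by (metis image_subset_iff)+
    let ?e1 = "vector [1, 0] :: complex^2" and ?e2 = "vector [0, 1] :: complex^2"
    have k1: "of_nat k + 1 \<noteq> (0 :: complex)" by (rule of_nat_plus_1_nonzero)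
    have 1: "?e2 \<in> W" if "?e1 \<in> W"
    proof -
      have "(1 / z) *s (rho2_N k l t z *v ?e1 - ((t + of_nat l - 1) / (of_nat k + 1)) *s ?e1) \<in> W"
        by (intro vec.subspace_scale vec.subspace_diff N that W)
      also have "(1 / z) *s (rho2_N k l t z *v ?e1 - ((t + of_nat l - 1) / (of_nat k + 1)) *s ?e1) = ?e2"
        using \<open>z \<noteq> 0\<close> by (simp add: rho2_N_mult vec_eq_iff forall_2)
      finally show ?thesis .
    qed
    have 2: "?e1 \<in> W" if "?e2 \<in> W"
    proof -
      let ?y = "(of_nat k * of_nat l - of_nat k - t) / (of_nat k + 1)"
      have "(1 / z) *s (rho2_N k l t z *v ?e2 - ?y *s ?e2) \<in> W"
        by (intro vec.subspace_scale vec.subspace_diff N that W)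
      also have "(1 / z) *s (rho2_N k l t z *v ?e2 - ?y *s ?e2) = ?e1"
        using \<open>z \<noteq> 0\<close> by (simp add: rho2_N_mult vec_eq_iff forall_2)
      finally show ?thesis .
    qed
    have "?e1 \<in> W \<or> ?e2 \<in> W"
    proof (cases "u $ 1 = 0")
      case True
      then have "u $ 2 \<noteq> 0" using u(2) by (simp add: vec_eq_iff forall_2)
      have "(1 / u $ 2) *s u \<in> W" by (intro vec.subspace_scale u W)
      also have "(1 / u $ 2) *s u = ?e2"
        using True \<open>u $ 2 \<noteq> 0\<close> by (simp add: vec_eq_iff forall_2)
      finally show ?thesis by blast
    next
      case False
      have "(1 / ((of_nat k + 1) * u $ 1)) *s (rho2_M k *v u + u) \<in> W"
        by (intro vec.subspace_scale vec.subspace_add M u W)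
      also have "(1 / ((of_nat k + 1) * u $ 1)) *s (rho2_M k *v u + u) = ?e1"
      proof -
        have "of_nat k * u $ 1 + u $ 1 = (of_nat k + 1) * u $ 1" by (simp add: algebra_simps)
        then show ?thesis using False k1 by (simp add: rho2_M_mult vec_eq_iff forall_2)
      qed
      finally show ?thesis by blast
    qed
    then have e: "?e1 \<in> W" "?e2 \<in> W" using 1 2 by blast+
    have "v \<in> W" for v
    proof -
      have "v $ 1 *s ?e1 + v $ 2 *s ?e2 \<in> W" by (intro vec.subspace_scale vec.subspace_add e W)
      also have "v $ 1 *s ?e1 + v $ 2 *s ?e2 = v" by (simp add: vec_eq_iff forall_2)
      finally show ?thesis .
    qed
    then show ?thesis by blast
  next
    case False
    then show ?thesis using vec.subspace_0[OF W] by blast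
  qed
  moreover have "(UNIV :: (complex^2) set) \<noteq> {0}" by (metis UNIV_I singletonD zero_neq_one)
  ultimately show ?thesis using rep unfolding irreducible_rep_def by blast
qed

lemma not_isomorphic_one_dim:
  assumes "a \<in> \<A>" "\<rho> a = (\<lambda>u. \<mu> * u)" "\<rho>' a = (\<lambda>u. \<mu>' * u)" "\<mu> \<noteq> \<mu>'"
  shows "\<not> isomorphic_reps \<A> (*) \<rho> (*) (\<rho>' :: 'e cmat \<Rightarrow> complex \<Rightarrow> complex)"
proof
  assume "isomorphic_reps \<A> (*) \<rho> (*) \<rho>'"
  then obtain \<phi> :: "complex \<Rightarrow> complex" where \<phi>: "Vector_Spaces.linear (*) (*) \<phi>" "bij \<phi>"
    "\<forall>a\<in>\<A>. \<forall>u. \<phi> (\<rho> a u) = \<rho>' a (\<phi> u)"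
    unfolding isomorphic_reps_def by blast
  obtain u where u: "\<phi> u = 1" using \<phi>(2) by (metis bij_pointE)
  have "\<phi> (\<mu> * u) = \<mu> * \<phi> u" by (rule linearD_explicit(2)[OF \<phi>(1)])
  moreover have "\<phi> (\<mu> * u) = \<mu>' * \<phi> u" using \<phi>(3) assms by metis
  ultimately show False using u assms(4) by simp
qed

text \<open>\<open>M\<close> is a scalar on a 1-dimensional representation, but has the distinct
  eigenvalues \<open>k\<close> and \<open>-1\<close> on U_t. The vector with both coordinates 1
  exhibits them together.\<close>

lemma not_isomorphic_one_two_dim:
  assumes "M \<in> \<A>" "\<rho> M = (\<lambda>u. \<mu> * u)" "\<sigma> M = (*v) (rho2_M k)"
  shows "\<not> isomorphic_reps \<A> (*) \<rho> (*s) (\<sigma> :: 'e cmat \<Rightarrow> complex^2 \<Rightarrow> complex^2)"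
proof
  assume "isomorphic_reps \<A> (*) \<rho> (*s) \<sigma>"
  then obtain \<phi> :: "complex \<Rightarrow> complex^2" where \<phi>: "Vector_Spaces.linear (*) (*s) \<phi>" "bij \<phi>"
    "\<forall>a\<in>\<A>. \<forall>u. \<phi> (\<rho> a u) = \<sigma> a (\<phi> u)"
    unfolding isomorphic_reps_def by blast
  have "rho2_M k *v w = \<mu> *s w" for w
  proof -
    obtain u where u: "\<phi> u = w" using \<phi>(2) by (metis bij_pointE)
    have "\<phi> (\<mu> * u) = \<mu> *s \<phi> u" by (rule linearD_explicit(2)[OF \<phi>(1)])
    moreover have "\<phi> (\<mu> * u) = rho2_M k *v \<phi> u" using \<phi>(3) assms by metis
    ultimately show ?thesis unfolding u by simp
  qed
  from this[of "vector [1, 1]"] have "of_nat k = \<mu>" "- 1 = \<mu>"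
    by (simp_all add: rho2_M_mult vec_eq_iff forall_2)
  then have "of_nat k + 1 = (0 :: complex)" by (metis add.left_inverse)
  with of_nat_plus_1_nonzero[of k] show False by contradiction
qed

text \<open>The central element \<open>C\<close> acts on \<open>U\<^sub>t\<close> as the scalar \<open>t\<close>.\<close>

lemma rho2_central:
  "rho2_M k *v (rho2_N k l t z *v u) + rho2_N k l t z *v (rho2_M k *v u)
    - (of_nat k - 1) *s (rho2_N k l t z *v u) - (of_nat l - 1) *s (rho2_M k *v u)
    + ((of_nat k - 1) * (of_nat l - 1)) *s u = t *s u"
proof -
  have "of_nat k + 1 \<noteq> (0 :: complex)" by (rule of_nat_plus_1_nonzero)
  then show ?thesis
    by (simp add: rho2_M_mult rho2_N_mult vec_eq_iff forall_2 divide_simps) (simp add: algebra_simps)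
qed

text \<open>The scalar by which \<open>C\<close> acts, \<open>t\<close> by
  \<open>rho2_central\<close>, is an isomorphism invariant.\<close>

lemma not_isomorphic_two_dim:
  assumes MN: "M \<in> \<A>" "N \<in> \<A>" "\<sigma> M = (*v) (rho2_M k)" "\<sigma> N = (*v) (rho2_N k l t z)"
      "\<sigma>' M = (*v) (rho2_M k)" "\<sigma>' N = (*v) (rho2_N k l t' z')"
    and "t \<noteq> t'"
  shows "\<not> isomorphic_reps \<A> (*s) \<sigma> (*s) (\<sigma>' :: 'e cmat \<Rightarrow> complex^2 \<Rightarrow> complex^2)"
proof
  assume "isomorphic_reps \<A> (*s) \<sigma> (*s) \<sigma>'"
  then obtain \<phi> :: "complex^2 \<Rightarrow> complex^2" where \<phi>: "Vector_Spaces.linear (*s) (*s) \<phi>" "bij \<phi>"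
    "\<forall>a\<in>\<A>. \<forall>u. \<phi> (\<sigma> a u) = \<sigma>' a (\<phi> u)"
    unfolding isomorphic_reps_def by blast
  interpret \<phi>: Vector_Spaces.linear "(*s)" "(*s)" \<phi> by (rule \<phi>(1))
  have M: "\<phi> (rho2_M k *v u) = rho2_M k *v \<phi> u" and N: "\<phi> (rho2_N k l t z *v u) = rho2_N k l t' z' *v \<phi> u" for u
    using \<phi>(3) MN by metis+
  obtain u where u: "\<phi> u = vector [1, 1]" using \<phi>(2) by (metis bij_pointE)
  have "t *s \<phi> u = \<phi> (t *s u)" by (rule \<phi>.scale[symmetric])
  also have "\<dots> = t' *s \<phi> u"
    unfolding rho2_central[of k l t z u, symmetric] rho2_central[of k l t' z' "\<phi> u", symmetric]
    by (simp only: \<phi>.add \<phi>.diff \<phi>.scale M N)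
  finally show False
    unfolding u using \<open>t \<noteq> t'\<close> by (simp add: vec_eq_iff forall_2)
qed

section \<open>The module of functions on the edges\<close>

context girth_deficiency_two
begin

abbreviation "\<A> \<equiv> adjacency_algebra E A B"

lemma M_in: "M \<in> \<A>" and N_in: "N \<in> \<A>" and one_in: "cmat_one E \<in> \<A>"
  by (auto simp: adjacency_algebra_def intro: generated_algebra.intros)

lemma W_in: "W i \<in> \<A>"
  using M_in N_in one_in unfolding adjacency_algebra_def
  by (induction i) (auto intro: generated_algebra.add generated_algebra.mult)

lemma W_rep:
  assumes "representation E \<A> s \<rho>"
  shows "\<rho> (W i) v = ((\<rho> N \<circ> \<rho> M) ^^ i) (v + \<rho> N v)"
proof (induction i)
  case (Suc i)
  have "cmat_mult E M (W i) \<in> \<A>"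
    using M_in W_in unfolding adjacency_algebra_def by (rule generated_algebra.mult)
  then show ?case using Suc by (simp add: representationD[OF assms] M_in N_in W_in)
qed (simp add: representationD[OF assms] N_in one_in)

text \<open>The relations are identities between matrices of the algebra, so each representation
  inherits them; \<open>M_W\<close> becomes the long relation through \<open>W_rep\<close>.\<close>

lemma hecke_of_rep:
  assumes rep: "representation E \<A> s \<rho>"
  shows "hecke_module s (\<rho> M) (\<rho> N) k l r"
proof (intro hecke_module.intro hecke_module_axioms.intro)
  show "vector_space s" "Vector_Spaces.linear s s (\<rho> M)" "Vector_Spaces.linear s s (\<rho> N)"
    using representationD[OF rep] M_in N_in by blast+
  have smult_in: "cmat_smult c a \<in> \<A>" if "a \<in> \<A>" for c a
    using that unfolding adjacency_algebra_def by (rule generated_algebra.smult)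
  have quad: "\<rho> X (\<rho> X v) = s (of_nat q - 1) (\<rho> X v) + s (of_nat q) v"
    if "cmat_mult E X X = cmat_add (cmat_smult (of_nat q - 1) X) (cmat_smult (of_nat q) (cmat_one E))"
      "X \<in> \<A>" for q X v
  proof -
    have "\<rho> X (\<rho> X v) = \<rho> (cmat_mult E X X) v" using that(2) by (simp add: representationD[OF rep])
    then show ?thesis using that one_in smult_in by (simp add: representationD[OF rep])
  qed
  show "\<rho> M (\<rho> M v) = s (of_nat k - 1) (\<rho> M v) + s (of_nat k) v" for v
    by (rule quad[OF share_quadratic[OF card_star_A] M_in])
  show "\<rho> N (\<rho> N v) = s (of_nat l - 1) (\<rho> N v) + s (of_nat l) v" for v
    by (rule quad[OF share_quadratic[OF card_star_B] N_in])
  show "\<rho> M (((\<rho> N \<circ> \<rho> M) ^^ r) (v + \<rho> N v)) = s (of_nat k) (((\<rho> N \<circ> \<rho> M) ^^ r) (v + \<rho> N v))" for v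
  proof -
    have "\<rho> M (\<rho> (W r) v) = \<rho> (cmat_mult E M (W r)) v"
      by (simp add: representationD[OF rep] M_in W_in)
    also have "\<dots> = s (of_nat k) (\<rho> (W r) v)"
      unfolding M_W by (simp add: representationD[OF rep] W_in)
    finally show ?thesis unfolding W_rep[OF rep] .
  qed
qed

lemma E_nonempty: "E \<noteq> {}"
  using far_edges by blast

text \<open>The constant vector is a common eigenvector of the generators, hence of the whole
  algebra. Its eigenvalue, the row sum, is the character U_{1,1}.\<close>

lemma row_sum_constant: "a \<in> \<A> \<Longrightarrow> \<exists>c. \<forall>e\<in>E. (\<Sum>f\<in>E. a e f) = c"
  unfolding adjacency_algebra_def
proof (induction rule: generated_algebra.induct)
  case one
  show ?case by (intro exI[of _ 1] ballI) (simp add: cmat_one_def finite_E)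
next
  case (gen a)
  have "(\<Sum>f\<in>E. M e f) = of_nat k" "(\<Sum>f\<in>E. N e f) = of_nat l" if "e \<in> E" for e
    using share_sum[OF that, of A "\<lambda>_. 1"] share_sum[OF that, of B "\<lambda>_. 1"]
      card_star_A[OF that] card_star_B[OF that] by simp_all
  then show ?case using gen by blast
next
  case (add a b)
  then obtain c c' where "\<forall>e\<in>E. (\<Sum>f\<in>E. a e f) = c" "\<forall>e\<in>E. (\<Sum>f\<in>E. b e f) = c'" by blast
  then show ?case by (intro exI[of _ "c + c'"]) (simp add: cmat_add_def sum.distrib)
next
  case (smult a d)
  then obtain c where "\<forall>e\<in>E. (\<Sum>f\<in>E. a e f) = c" by blast
  then show ?case by (intro exI[of _ "d * c"]) (simp add: cmat_smult_def sum_distrib_left[symmetric])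
next
  case (mult a b)
  then obtain c c' where c: "\<forall>e\<in>E. (\<Sum>f\<in>E. a e f) = c" "\<forall>e\<in>E. (\<Sum>f\<in>E. b e f) = c'" by blast
  have "(\<Sum>f\<in>E. cmat_mult E a b e f) = c * c'" if "e \<in> E" for e
  proof -
    have "(\<Sum>f\<in>E. cmat_mult E a b e f) = (\<Sum>g\<in>E. a e g * (\<Sum>f\<in>E. b g f))"
      unfolding cmat_mult_def sum_distrib_left by (rule sum.swap)
    also have "\<dots> = (\<Sum>g\<in>E. a e g * c')" using c by (intro sum.cong) auto
    finally show ?thesis using c(1) that by (simp add: sum_distrib_right[symmetric])
  qed
  then show ?case by blast
qed

definition row_sum :: "'v set cmat \<Rightarrow> complex" where
  "row_sum a = (\<Sum>f\<in>E. a (SOME e. e \<in> E) f)"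

lemma row_sum: "a \<in> \<A> \<Longrightarrow> e \<in> E \<Longrightarrow> (\<Sum>f\<in>E. a e f) = row_sum a"
  using row_sum_constant[of a] E_nonempty some_in_eq[of E] unfolding row_sum_def by metis

text \<open>As the type consists of functions on all sets of
  vertices, the algebra acts on the values outside \<open>E\<close> through the character \<open>U\<^sub>1\<^sub>,\<^sub>1\<close>.\<close>

definition act :: "'v set cmat \<Rightarrow> ('v set \<Rightarrow> complex) \<Rightarrow> 'v set \<Rightarrow> complex" where
  "act a w = (\<lambda>e. if e \<in> E then \<Sum>f\<in>E. a e f * w f else row_sum a * w e)"

lemma act_representation: "representation E \<A> fscale act"
  unfolding representation_def
proof (intro conjI ballI allI)
  obtain e\<^sub>0 where e0: "e\<^sub>0 \<in> E" using E_nonempty by blast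
  show "vector_space (fscale :: _ \<Rightarrow> ('v set \<Rightarrow> complex) \<Rightarrow> _)" by (rule vector_space_fscale)
  show "Vector_Spaces.linear fscale fscale (act a)" if "a \<in> \<A>" for a
    by (intro linearI_explicit vector_space_fscale ext)
      (simp_all add: act_def fscale_def algebra_simps sum.distrib sum_distrib_left)
  have "row_sum (cmat_one E) = 1"
    using row_sum[OF one_in e0] e0 by (simp add: cmat_one_def finite_E)
  then show "act (cmat_one E) = id"
    by (intro ext) (simp add: act_def cmat_one_def finite_E if_distrib[of "\<lambda>x. x * _"] cong: if_cong)
  show "act (cmat_add a b) = (\<lambda>u. act a u + act b u)" if "a \<in> \<A>" "b \<in> \<A>" for a b
    by (intro ext) (simp add: act_def cmat_add_def row_sum_def sum.distrib algebra_simps)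
  show "act (cmat_smult c a) = (\<lambda>u. fscale c (act a u))" if "a \<in> \<A>" for c a
    by (intro ext) (simp add: act_def cmat_smult_def fscale_def row_sum_def sum_distrib_left mult.assoc)
  show "act (cmat_mult E a b) = act a \<circ> act b" if ab: "a \<in> \<A>" "b \<in> \<A>" for a b
  proof (intro ext)
    fix w e
    have ab_in: "cmat_mult E a b \<in> \<A>"
      using ab unfolding adjacency_algebra_def by (rule generated_algebra.mult)
    \<comment> \<open>Outside \<open>E\<close> an element acts by its row sum, so multiplicativity
      there is multiplicativity of \<open>row_sum\<close>.\<close>
    have "row_sum (cmat_mult E a b) = (\<Sum>f\<in>E. cmat_mult E a b e\<^sub>0 f)"
      by (rule row_sum[OF ab_in e0, symmetric])
    also have "\<dots> = (\<Sum>g\<in>E. a e\<^sub>0 g * (\<Sum>f\<in>E. b g f))"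
      unfolding cmat_mult_def sum_distrib_left by (rule sum.swap)
    also have "\<dots> = (\<Sum>g\<in>E. a e\<^sub>0 g * row_sum b)"
      using row_sum[OF ab(2)] by (intro sum.cong) auto
    also have "\<dots> = row_sum a * row_sum b"
      unfolding row_sum[OF ab(1) e0, symmetric] by (simp add: sum_distrib_right)
    finally have "row_sum (cmat_mult E a b) = row_sum a * row_sum b" .
    moreover have "(\<Sum>f\<in>E. cmat_mult E a b e f * w f) = (\<Sum>g\<in>E. a e g * (\<Sum>f\<in>E. b g f * w f))"
      unfolding cmat_mult_def sum_distrib_left sum_distrib_right mult.assoc by (rule sum.swap)
    ultimately show "act (cmat_mult E a b) w e = (act a \<circ> act b) w e"
      by (simp add: act_def cong: sum.cong)
  qed
qed

sublocale fn: hecke_module fscale "act M" "act N" k l r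
  by (rule hecke_of_rep[OF act_representation])

lemma act_plus: "e \<in> E \<Longrightarrow> (w + act (share_matrix E D) w) e = (\<Sum>g\<in>star D e. w g)"
  by (simp add: act_def share_sum)

end

lemma sum_fun_apply: "(\<Sum>i\<in>I. f i) x = (\<Sum>i\<in>I. f i x)"
  by (induction I rule: infinite_finite_induct) simp_all

context girth_deficiency_two
begin

lemma mem_star_A: "e \<in> E \<Longrightarrow> g \<in> star A e \<longleftrightarrow> g \<in> E \<and> end_in A g = end_in A e"
  and mem_star_B: "e \<in> E \<Longrightarrow> g \<in> star B e \<longleftrightarrow> g \<in> E \<and> end_in B g = end_in B e"
  using star_eq[of e A] star_eq[of e B] by blast+

text \<open>\<open>w + M w\<close> is the indicator of the star of \<open>f\<close> at
  \<open>A\<close>. On the \<open>k\<close>-eigenspace of \<open>M\<close>, \<open>C\<close> is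
  \<open>(1 + M) (1 + N) - (k + l)\<close>, whose first part has nonnegative entries and reaches
  exactly two levels further. Only edges with \<open>d e \<ge> 2 i\<close> are controlled, since
  further inside the negative term interferes.\<close>

lemma C_power_support:
  assumes f: "f \<in> E"
  defines "d \<equiv> \<lambda>e. gdist E (end_in A f) (end_in A e)"
    and "w \<equiv> \<lambda>e. if e = f then 1 else 0 :: complex"
  shows "e \<in> E \<Longrightarrow> 2 * i \<le> d e \<Longrightarrow> (d e = 2 * i \<longrightarrow> Re ((fn.C ^^ i) (w + act M w) e) > 0) \<and>
    (d e \<noteq> 2 * i \<longrightarrow> (fn.C ^^ i) (w + act M w) e = 0)"
proof (induction i arbitrary: e)
  case 0
  have "end_in A f \<in> A" "end_in A e \<in> A"
    using end_in_pair(2)[OF f, of A B] end_in_pair(2)[OF 0(1), of A B] by simp_all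
  then have V: "end_in A f \<in> V" "end_in A e \<in> V" using AB(1) by blast+
  have "d e = 0 \<longleftrightarrow> end_in A f = end_in A e"
    using gdist_0[OF V] gdist_self[of "end_in A f"] unfolding d_def by metis
  moreover have "(w + act M w) e = (if f \<in> star A e then 1 else 0)"
    unfolding act_plus[OF 0(1)] w_def using finite_star by simp
  moreover have "f \<in> star A e \<longleftrightarrow> end_in A f = end_in A e"
    using mem_star_A[OF 0(1)] f by blast
  ultimately show ?case by (simp del: plus_fun_apply)
next
  case (Suc i)
  define g where "g = (fn.C ^^ i) (w + act M w)"
  note IH = Suc.IH[folded g_def]
  have af: "end_in A f \<in> V" using end_in_pair(2)[OF f, of A B] AB(1) by auto
  \<comment> \<open>\<open>C\<close> commutes with \<open>M\<close>, so its powers preserve the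
    \<open>k\<close>-eigenspace.\<close>
  have "act M ((fn.C ^^ j) (w + act M w)) = fscale (of_nat k) ((fn.C ^^ j) (w + act M w))" for j
  proof (induction j)
    case 0
    show ?case using fn.m_plus[of w] by (simp only: funpow_0)
  next
    case (Suc j)
    then show ?case by (simp only: funpow.simps o_apply fn.m_C fn.C.c_simps)
  qed
  then have mg: "act M g = fscale (of_nat k) g" unfolding g_def .
  \<comment> \<open>Beyond level \<open>2 i\<close> the function \<open>g\<close> vanishes, so the
    term \<open>- (k + l) g\<close> contributes nothing at \<open>e\<close>.\<close>
  have "2 * i \<le> d e" "d e \<noteq> 2 * i" using Suc.prems(2) by simp_all
  then have "g e = 0" using IH[OF Suc.prems(1)] by blast
  have Ce: "(fn.C ^^ Suc i) (w + act M w) e = (\<Sum>e'\<in>star A e. \<Sum>e''\<in>star B e'. g e'')"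
  proof -
    have "(fn.C ^^ Suc i) (w + act M w) e = ((g + act N g) + act M (g + act N g)) e"
      using fn.C_on_m_eigenspace[OF mg] \<open>g e = 0\<close> unfolding g_def[symmetric]
      by (simp add: g_def[symmetric] fscale_def)
    also have "\<dots> = (\<Sum>e'\<in>star A e. \<Sum>e''\<in>star B e'. g e'')"
      unfolding act_plus[OF Suc.prems(1)] by (intro sum.cong refl act_plus) (rule star_subset)
    finally show ?thesis .
  qed
  have near: "d e \<le> d e'' + 2" if e': "e' \<in> star A e" and e'': "e'' \<in> star B e'" for e' e''
  proof -
    note E = star_subset[OF e'] star_subset[OF e'']
    have ends: "end_in A e' = end_in A e" "end_in B e'' = end_in B e'"
      using e' e'' mem_star_A[OF Suc.prems(1)] mem_star_B[OF E(1)] by blast+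
    have "{end_in B e', end_in A e} \<in> E"
      using end_in_pair(1)[OF E(1), of B A] E(1) ends(1) by simp
    moreover have "{end_in A e'', end_in B e'} \<in> E"
      using end_in_pair(1)[OF E(2), of A B] E(2) ends(2) by simp
    ultimately show ?thesis
      using gdist_step_le[OF af, of "end_in B e'" "end_in A e"] gdist_step_le[OF af, of "end_in A e''" "end_in B e'"]
      unfolding d_def by linarith
  qed
  \<comment> \<open>Two steps back along a shortest path to \<open>end_in A f\<close> give a
    strictly positive summand.\<close>
  have ex: "\<exists>e'\<in>star A e. \<exists>e''\<in>star B e'. d e'' = 2 * i" if de: "d e = 2 * Suc i"
  proof -
    have a: "end_in A e \<in> A" using end_in_pair(2)[OF Suc.prems(1), of A B] by simp
    then have "end_in A e \<in> V" using AB(1) by blast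
    then obtain b where b: "{b, end_in A e} \<in> E" "gdist E (end_in A f) b = Suc (2 * i)"
      using gdist_pred[OF af, of "end_in A e" "Suc (2 * i)"] de unfolding d_def by auto
    have e': "{end_in A e, b} \<in> E" using b(1) by (simp add: insert_commute)
    note ends = end_in_insert[OF e' a, of B]
    have bB: "b \<in> B" using end_in_pair(3)[OF e', of A B] ends by simp
    then have "b \<in> V" using AB(1) by blast
    then obtain c where c: "{c, b} \<in> E" "gdist E (end_in A f) c = 2 * i"
      using gdist_pred[OF af _ b(2)] by blast
    have e'': "{b, c} \<in> E" using c(1) by (simp add: insert_commute)
    note ends' = end_in_insert[OF e'' bB, of A]
    have "{end_in A e, b} \<in> star A e" using mem_star_A[OF Suc.prems(1)] e' ends by blast
    moreover have "{b, c} \<in> star B {end_in A e, b}" using mem_star_B[OF e'] e'' ends ends' by simp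
    moreover have "d {b, c} = 2 * i" using c(2) ends' unfolding d_def by simp
    ultimately show ?thesis by blast
  qed
  show ?case
  proof (intro conjI impI)
    assume "d e \<noteq> 2 * Suc i"
    then have "g e'' = 0" if "e' \<in> star A e" "e'' \<in> star B e'" for e' e''
      using near[OF that] IH[of e''] star_subset[OF that(2)] Suc.prems(2) by simp
    then show "(fn.C ^^ Suc i) (w + act M w) e = 0"
      unfolding Ce by (intro sum.neutral ballI)
  next
    assume de: "d e = 2 * Suc i"
    \<comment> \<open>All edges reached still have level at least \<open>2 i\<close>, where the
      induction hypothesis gives a positive real part or zero.\<close>
    have nonneg: "Re (g e'') \<ge> 0" if "e' \<in> star A e" "e'' \<in> star B e'" for e' e''
      using near[OF that] IH[of e''] star_subset[OF that(2)] de
      by (cases "d e'' = 2 * i") auto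
    obtain e1 e2 where e12: "e1 \<in> star A e" "e2 \<in> star B e1" "d e2 = 2 * i" using ex[OF de] by blast
    have "Re (g e2) > 0" using IH[of e2] star_subset[OF e12(2)] e12(3) by simp
    then have "(\<Sum>e''\<in>star B e1. Re (g e'')) > 0"
      by (rule sum_pos2[OF finite_star e12(2)]) (rule nonneg[OF e12(1)])
    then have "(\<Sum>e'\<in>star A e. \<Sum>e''\<in>star B e'. Re (g e'')) > 0"
      by (rule sum_pos2[OF finite_star e12(1)]) (intro sum_nonneg nonneg)
    then show "Re ((fn.C ^^ Suc i) (w + act M w) e) > 0" unfolding Ce by simp
  qed
qed

text \<open>Let \<open>w\<close> be the indicator of an edge \<open>f\<close> and let
  \<open>e\<close> have its end in \<open>A\<close> at distance \<open>2 r + 2\<close> from that of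
  \<open>f\<close>. At \<open>e\<close> the vectors \<open>C^i (w + M w)\<close> vanish for
  \<open>i \<le> r\<close> but not for \<open>i = r + 1\<close>, so the leading term survives. One
  \<open>w\<close> serves all polynomials of this degree.\<close>

lemma poly_C_nonzero:
  "\<exists>w. \<forall>p. degree p = Suc r \<longrightarrow> fn.C.poly_op p (w + act M w) \<noteq> 0"
proof -
  obtain e f where ef: "e \<in> E" "f \<in> E" "gdist E (end_in A f) (end_in A e) = 2 * r + 2"
    using far_edges by blast
  define w :: "'v set \<Rightarrow> complex" where "w = (\<lambda>e. if e = f then 1 else 0)"
  have low: "(fn.C ^^ i) (w + act M w) e = 0" if "i < Suc r" for i
    using C_power_support[OF ef(2,1), of i] ef(3) that unfolding w_def by simp
  have high: "(fn.C ^^ Suc r) (w + act M w) e \<noteq> 0"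
    using C_power_support[OF ef(2,1), of "Suc r"] ef(3) unfolding w_def by auto
  have "fn.C.poly_op p (w + act M w) \<noteq> 0" if p: "degree p = Suc r" for p
  proof -
    have "fn.C.poly_op p (w + act M w) e = (\<Sum>i\<le>Suc r. coeff p i * (fn.C ^^ i) (w + act M w) e)"
      unfolding fn.C.poly_op_def p sum_fun_apply fscale_def by simp
    also have "\<dots> = coeff p (Suc r) * (fn.C ^^ Suc r) (w + act M w) e"
      using low by (simp add: lessThan_Suc_atMost[symmetric] del: funpow.simps)
    finally have "fn.C.poly_op p (w + act M w) e \<noteq> 0"
      using high p leading_coeff_0_iff[of p] by auto
    then show ?thesis by auto
  qed
  then show ?thesis by blast
qed

end

section \<open>Existence and classification\<close>

context girth_deficiency_two
begin

lemma one_dim_representation: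
  assumes "w \<noteq> 0" "act M w = fscale \<mu> w" "act N w = fscale \<nu> w"
  shows "\<exists>\<rho> :: 'v set cmat \<Rightarrow> complex \<Rightarrow> complex.
    irreducible_rep E \<A> (*) \<rho> \<and> \<rho> M = (\<lambda>u. \<mu> * u) \<and> \<rho> N = (\<lambda>u. \<nu> * u)"
proof -
  have lin: "Vector_Spaces.linear (*) fscale (\<lambda>c. fscale c w)"
    by (intro linearI_explicit vector_space_over_itself.vector_space_axioms vector_space_fscale)
      (simp_all add: fn.scale_left_distrib)
  have inj: "inj (\<lambda>c. fscale c w)" using assms(1) by (auto intro: injI)
  have scale: "act a (fscale c w) = fscale (\<mu>' * c) w" if "a \<in> \<A>" "act a w = fscale \<mu>' w" for a c \<mu>'
    unfolding linearD_explicit(2)[OF representationD(3)[OF act_representation that(1)]] that(2) fn.scale_scale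
    by (simp only: mult.commute)
  have "\<exists>\<rho> :: 'v set cmat \<Rightarrow> complex \<Rightarrow> complex. representation E \<A> (*) \<rho> \<and>
      \<rho> M = (\<lambda>u. \<mu> * u) \<and> \<rho> N = (\<lambda>u. \<nu> * u)"
    unfolding adjacency_algebra_def
    by (rule subrepresentation[where \<rho> = act and \<phi> = "\<lambda>c. fscale c w" and m = "(*) \<mu>" and n = "(*) \<nu>",
          OF act_representation[unfolded adjacency_algebra_def] vector_space_over_itself.vector_space_axioms lin inj])
      (rule scale[OF M_in assms(2)], rule scale[OF N_in assms(3)])
  then obtain \<rho> :: "'v set cmat \<Rightarrow> complex \<Rightarrow> complex" where
    \<rho>: "representation E \<A> (*) \<rho>" "\<rho> M = (\<lambda>u. \<mu> * u)" "\<rho> N = (\<lambda>u. \<nu> * u)"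
    by (elim exE conjE) (rule that)
  show ?thesis
    by (intro exI[of _ \<rho>] conjI irreducible_one_dim \<rho>)
qed

text \<open>Spanned by the constant function 1; the action outside \<open>E\<close> by row sums is
  compatible with it.\<close>

lemma exists_U11:
  "\<exists>\<rho> :: 'v set cmat \<Rightarrow> complex \<Rightarrow> complex. irreducible_rep E \<A> (*) \<rho> \<and>
    \<rho> M = (\<lambda>u. of_nat k * u) \<and> \<rho> N = (\<lambda>u. of_nat l * u)"
proof (rule one_dim_representation)
  have "row_sum M = of_nat k" "row_sum N = of_nat l"
  proof -
    obtain e where e: "e \<in> E" using E_nonempty by blast
    show "row_sum M = of_nat k" "row_sum N = of_nat l"
      using share_sum[OF e, of A "\<lambda>_. 1"] share_sum[OF e, of B "\<lambda>_. 1"]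
        card_star_A[OF e] card_star_B[OF e] row_sum[OF M_in e] row_sum[OF N_in e] by simp_all
  qed
  then show "act M (\<lambda>_. 1) = fscale (of_nat k) (\<lambda>_. 1)" "act N (\<lambda>_. 1) = fscale (of_nat l) (\<lambda>_. 1)"
    by (auto simp: act_def fscale_def row_sum M_in N_in)
  show "(\<lambda>_. 1) \<noteq> (0 :: 'v set \<Rightarrow> complex)" by (auto simp: fun_eq_iff)
qed

lemma exists_U12:
  "\<exists>\<rho> :: 'v set cmat \<Rightarrow> complex \<Rightarrow> complex. irreducible_rep E \<A> (*) \<rho> \<and>
    \<rho> M = (\<lambda>u. - 1 * u) \<and> \<rho> N = (\<lambda>u. - 1 * u)"
proof -
  obtain w :: "'v set \<Rightarrow> complex" where w: "\<forall>e. e \<notin> E \<longrightarrow> w e = 0" "w \<noteq> (\<lambda>_. 0)"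
    "\<And>v. (\<Sum>g\<in>{g \<in> E. v \<in> g}. w g) = 0"
    using alternating_function by blast
  have "act (share_matrix E D) w = fscale (- 1) w" if D: "D \<in> {A, B}" for D
  proof (rule ext)
    fix e
    show "act (share_matrix E D) w e = fscale (- 1) w e"
    proof (cases "e \<in> E")
      case True
      \<comment> \<open>The star sums of \<open>w\<close> vanish, so only the subtracted diagonal
        term \<open>- w e\<close> is left.\<close>
      then show ?thesis
        unfolding act_def fscale_def if_P[OF True] share_sum[OF True] star_eq_incident[OF True D] w(3)
        by simp
    next
      case False
      then show ?thesis using w(1) by (simp add: act_def fscale_def)
    qed
  qed
  moreover have "w \<noteq> 0" using w(2) by (auto simp: fun_eq_iff)
  ultimately show ?thesis by (intro one_dim_representation) blast+
qed

lemma degree_annihilator: "degree (cF k l r * [:c, 1:]) = Suc r"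
  using cF_nonzero by (subst degree_mult_eq) (simp_all add: degree_cF)

lemma exists_U13:
  "\<exists>\<rho> :: 'v set cmat \<Rightarrow> complex \<Rightarrow> complex. irreducible_rep E \<A> (*) \<rho> \<and>
    \<rho> M = (\<lambda>u. of_nat k * u) \<and> \<rho> N = (\<lambda>u. - 1 * u)"
proof -
  obtain w where w: "\<forall>p. degree p = Suc r \<longrightarrow> fn.C.poly_op p (w + act M w) \<noteq> 0"
    using poly_C_nonzero by blast
  have "fn.U13_vector w \<noteq> 0" unfolding fn.U13_vector_def using w degree_annihilator by blast
  moreover have "act N (fn.U13_vector w) = fscale (- 1) (fn.U13_vector w)"
    unfolding fn.n_U13_vector by (simp add: fscale_def fun_eq_iff)
  ultimately show ?thesis using fn.m_U13_vector[of w] by (intro one_dim_representation)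
qed

text \<open>The vector of \<open>C_eigenvector\<close> is a polynomial of degree
  \<open>r + 1\<close> in \<open>C\<close> applied to \<open>w + M w\<close>, hence nonzero for the
  \<open>w\<close> of \<open>poly_C_nonzero\<close>; it generates a copy of U_t.\<close>

lemma exists_U_t:
  assumes t: "t \<in> F_roots k l r"
    and z: "z\<^sup>2 = (1 + of_nat k * of_nat l - t) * (t + of_nat k + of_nat l) / (of_nat k + 1)\<^sup>2"
  shows "\<exists>\<sigma> :: 'v set cmat \<Rightarrow> complex^2 \<Rightarrow> complex^2. irreducible_rep E \<A> (*s) \<sigma> \<and>
    \<sigma> M = (*v) (rho2_M k) \<and> \<sigma> N = (*v) (rho2_N k l t z)"
proof -
  have z0: "z \<noteq> 0"
    using F_root_factors_nonzero[OF l_pos t] z of_nat_plus_1_nonzero[of k] by auto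
  have "poly (cF k l r) t = 0" using t by (simp add: F_roots_eq)
  then obtain q where q: "cF k l r = [:- t, 1:] * q" by (metis poly_eq_0_iff_dvd dvdE)
  have "q \<noteq> 0" using q cF_nonzero[of k l r] by auto
  moreover have "degree ([:- t, 1:] * q) = r" using degree_cF[of k l r] q by simp
  ultimately have "Suc (degree q) = r"
    by (subst (asm) degree_mult_eq) simp_all
  \<comment> \<open>The degrees add up to \<open>(r - 1) + 1 + 1\<close>.\<close>
  then have deg: "degree (q * [:- (1 + of_nat k * of_nat l), 1:] * [:of_nat k + of_nat l, 1:]) = Suc r"
    using \<open>q \<noteq> 0\<close> by (simp add: degree_mult_eq del: mult_pCons_right)
  obtain w where w: "\<forall>p. degree p = Suc r \<longrightarrow> fn.C.poly_op p (w + act M w) \<noteq> 0"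
    using poly_C_nonzero by blast
  let ?e = "fn.C.poly_op (q * [:- (1 + of_nat k * of_nat l), 1:] * [:of_nat k + of_nat l, 1:]) (w + act M w)"
  have "?e \<noteq> 0" using w deg by blast
  from fn.rank_two_submodule[OF this fn.C_eigenvector(2,1)[OF q] z0 z]
  obtain \<phi> :: "complex^2 \<Rightarrow> 'v set \<Rightarrow> complex" where \<phi>: "Vector_Spaces.linear (*s) fscale \<phi>" "inj \<phi>"
    "\<forall>u. act M (\<phi> u) = \<phi> (rho2_M k *v u)" "\<forall>u. act N (\<phi> u) = \<phi> (rho2_N k l t z *v u)"
    by (elim exE conjE) (rule that)
  have "\<exists>\<sigma>. representation E \<A> (*s) \<sigma> \<and> \<sigma> M = (*v) (rho2_M k) \<and> \<sigma> N = (*v) (rho2_N k l t z)"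
    unfolding adjacency_algebra_def
    by (rule subrepresentation[where \<rho> = act and \<phi> = \<phi> and m = "(*v) (rho2_M k)" and n = "(*v) (rho2_N k l t z)",
          OF act_representation[unfolded adjacency_algebra_def] vec.vector_space_axioms \<phi>(1,2)])
      (rule \<phi>(3)[rule_format], rule \<phi>(4)[rule_format])
  then obtain \<sigma> where \<sigma>: "representation E \<A> (*s) \<sigma>" "\<sigma> M = (*v) (rho2_M k)" "\<sigma> N = (*v) (rho2_N k l t z)"
    by (elim exE conjE) (rule that)
  have "irreducible_rep E \<A> (*s) \<sigma>"
    by (rule irreducible_two_dim[where \<sigma> = \<sigma> and M = M and N = N, OF \<sigma>(1) M_in N_in \<sigma>(2,3) z0])
  then show ?thesis using \<sigma>(2,3) by (intro exI[of _ \<sigma>] conjI)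
qed

text \<open>A subspace invariant under the generators \<open>M\<close> and \<open>N\<close> is
  invariant under the whole algebra.\<close>

lemma irreducible_module_of_rep:
  assumes "irreducible_rep E \<A> s \<rho>"
  shows "hecke_module.irreducible_module s (\<rho> M) (\<rho> N)"
proof -
  have rep: "representation E \<A> s \<rho>" using assms unfolding irreducible_rep_def by (elim conjE)
  interpret hecke_module s "\<rho> M" "\<rho> N" k l r by (rule hecke_of_rep[OF rep])
  show ?thesis
    unfolding irreducible_module_def
  proof (intro allI impI)
    fix W assume W: "subspace W \<and> \<rho> M ` W \<subseteq> W \<and> \<rho> N ` W \<subseteq> W"
    have gens: "\<rho> a ` W \<subseteq> W" if "a \<in> {M, N}" for a
      using that W by (elim insertE emptyE) simp_all
    have "\<rho> a ` W \<subseteq> W" if "a \<in> \<A>" for a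
      by (rule invariant_under_generated_algebra[where \<rho> = \<rho> and S = "{M, N}" and W = W,
            OF rep[unfolded adjacency_algebra_def] conjunct1[OF W] gens that[unfolded adjacency_algebra_def]])
    then have "subspace W \<and> (\<forall>a\<in>\<A>. \<rho> a ` W \<subseteq> W)" using W by (intro conjI ballI) simp_all
    moreover have "\<forall>W. subspace W \<and> (\<forall>a\<in>\<A>. \<rho> a ` W \<subseteq> W) \<longrightarrow> W = {0} \<or> W = UNIV"
      using assms unfolding irreducible_rep_def by (elim conjE)
    ultimately show "W = {0} \<or> W = UNIV" by (elim allE[of _ W]) (rule mp)
  qed
qed

text \<open>The classification yields a map from the model into the module, whereas the isomorphism
  required goes the other way; its inverse intertwines the generators and therefore the
  algebra.\<close>

lemma isomorphicI:
  assumes rep: "representation E \<A> s \<rho>" and rep': "representation E \<A> s' \<rho>'"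
    and \<phi>: "Vector_Spaces.linear s' s \<phi>" "bij \<phi>"
    and MN: "\<And>u. \<rho> M (\<phi> u) = \<phi> (\<rho>' M u)" "\<And>u. \<rho> N (\<phi> u) = \<phi> (\<rho>' N u)"
  shows "isomorphic_reps \<A> s \<rho> s' \<rho>'"
proof -
  have inv: "inv \<phi> (\<phi> u) = u" "\<phi> (inv \<phi> v) = v" for u v
    using \<phi>(2) by (simp_all add: bij_is_inj bij_is_surj surj_f_inv_f)
  have eqI: "x = y" if "\<phi> x = \<phi> y" for x y using that \<phi>(2) by (meson bij_is_inj injD)
  have lin: "Vector_Spaces.linear s s' (inv \<phi>)"
    by (intro linearI_explicit representationD(1)[OF rep] representationD(1)[OF rep']; rule eqI)
      (simp_all add: inv linearD_explicit[OF \<phi>(1)])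
  have gens: "inv \<phi> (\<rho> a u) = \<rho>' a (inv \<phi> u)" if "a \<in> {M, N}" for a u
  proof (rule eqI)
    show "\<phi> (inv \<phi> (\<rho> a u)) = \<phi> (\<rho>' a (inv \<phi> u))"
      using that by (elim insertE emptyE) (simp_all only: MN[symmetric] inv)
  qed
  have "inv \<phi> (\<rho> a u) = \<rho>' a (inv \<phi> u)" if "a \<in> \<A>" for a u
    by (rule intertwiner_on_generated_algebra[where \<rho> = \<rho> and \<rho>' = \<rho>' and S = "{M, N}" and \<phi> = "inv \<phi>",
          OF rep[unfolded adjacency_algebra_def] rep'[unfolded adjacency_algebra_def] lin gens
          that[unfolded adjacency_algebra_def]])
  then show ?thesis
    unfolding isomorphic_reps_def using lin bij_imp_bij_inv[OF \<phi>(2)] by blast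
qed

lemma irreducible_rep_classification:
  fixes s :: "complex \<Rightarrow> 'u::ab_group_add \<Rightarrow> 'u"
  assumes irr: "irreducible_rep E \<A> s \<rho>"
    and z: "\<And>t. t \<in> F_roots k l r \<Longrightarrow>
      (z t)\<^sup>2 = (1 + of_nat k * of_nat l - t) * (t + of_nat k + of_nat l) / (of_nat k + 1)\<^sup>2"
    and \<rho>1: "representation E \<A> (*) \<rho>\<^sub>1" "\<rho>\<^sub>1 M = (\<lambda>u. of_nat k * u)" "\<rho>\<^sub>1 N = (\<lambda>u. of_nat l * u)"
    and \<rho>2: "representation E \<A> (*) \<rho>\<^sub>2" "\<rho>\<^sub>2 M = (\<lambda>u. - 1 * u)" "\<rho>\<^sub>2 N = (\<lambda>u. - 1 * u)"
    and \<rho>3: "representation E \<A> (*) \<rho>\<^sub>3" "\<rho>\<^sub>3 M = (\<lambda>u. of_nat k * u)" "\<rho>\<^sub>3 N = (\<lambda>u. - 1 * u)"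
    and \<sigma>: "\<And>t. t \<in> F_roots k l r \<Longrightarrow> representation E \<A> (*s) (\<sigma> t)"
      "\<And>t. t \<in> F_roots k l r \<Longrightarrow> \<sigma> t M = (*v) (rho2_M k)"
      "\<And>t. t \<in> F_roots k l r \<Longrightarrow> \<sigma> t N = (*v) (rho2_N k l t (z t))"
  shows "(\<exists>\<rho>'\<in>{\<rho>\<^sub>1, \<rho>\<^sub>2, \<rho>\<^sub>3}. isomorphic_reps \<A> s \<rho> (*) \<rho>') \<or>
    (\<exists>t\<in>F_roots k l r. isomorphic_reps \<A> s \<rho> (*s) (\<sigma> t))"
proof -
  have rep: "representation E \<A> s \<rho>" using irr unfolding irreducible_rep_def by blast
  have nz: "UNIV \<noteq> {0 :: 'u}" using irr unfolding irreducible_rep_def by blast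
  interpret h: hecke_module s "\<rho> M" "\<rho> N" k l r by (rule hecke_of_rep[OF rep])
  from h.irreducible_module_cases[OF irreducible_module_of_rep[OF irr] nz l_pos z]
  consider (one) \<mu> \<nu> \<phi> where "(\<mu>, \<nu>) \<in> {(of_nat k, of_nat l), (-1, -1), (of_nat k, -1)}"
      "Vector_Spaces.linear (*) s \<phi>" "bij \<phi>"
      "\<And>u. \<rho> M (\<phi> u) = \<phi> (\<mu> * u)" "\<And>u. \<rho> N (\<phi> u) = \<phi> (\<nu> * u)"
    | (two) t \<phi> where "t \<in> F_roots k l r" "Vector_Spaces.linear (*s) s \<phi>" "bij \<phi>"
      "\<And>u. \<rho> M (\<phi> u) = \<phi> (rho2_M k *v u)" "\<And>u. \<rho> N (\<phi> u) = \<phi> (rho2_N k l t (z t) *v u)"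
    by blast
  then show ?thesis
  proof cases
    case one
    from one(1) consider "\<mu> = of_nat k" "\<nu> = of_nat l" | "\<mu> = -1" "\<nu> = -1" | "\<mu> = of_nat k" "\<nu> = -1"
      by blast
    then show ?thesis
    proof cases
      case 1
      have "isomorphic_reps \<A> s \<rho> (*) \<rho>\<^sub>1"
        using one(4,5) by (intro isomorphicI[OF rep \<rho>1(1) one(2,3)]) (simp_all add: 1 \<rho>1)
      then show ?thesis by blast
    next
      case 2
      have "isomorphic_reps \<A> s \<rho> (*) \<rho>\<^sub>2"
        using one(4,5) by (intro isomorphicI[OF rep \<rho>2(1) one(2,3)]) (simp_all add: 2 \<rho>2)
      then show ?thesis by blast
    next
      case 3
      have "isomorphic_reps \<A> s \<rho> (*) \<rho>\<^sub>3"
        using one(4,5) by (intro isomorphicI[OF rep \<rho>3(1) one(2,3)]) (simp_all add: 3 \<rho>3)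
      then show ?thesis by blast
    qed
  next
    case two
    have "isomorphic_reps \<A> s \<rho> (*s) (\<sigma> t)"
      by (rule isomorphicI[OF rep \<sigma>(1)[OF two(1)] two(2,3)]) (simp_all add: two(4,5) \<sigma>(2,3)[OF two(1)])
    then show ?thesis using two(1) by blast
  qed
qed

end

section \<open>From the hypotheses on the graph to the locale\<close>

lemma girth_finiteD:
  assumes "girth E = enat g"
  shows "is_cycle E c \<Longrightarrow> g \<le> length c" "\<exists>c. is_cycle E c \<and> length c = g"
proof -
  show "g \<le> length c" if "is_cycle E c"
    using INF_lower[of c "{c. is_cycle E c}" "\<lambda>c. enat (length c)"] that assms unfolding girth_def by simp
  let ?L = "(\<lambda>c. enat (length c)) ` {c. is_cycle E c}"
  \<comment> \<open>The empty infimum is \<infinity>, so a finite girth provides a cycle, and the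
    infimum is attained.\<close>
  have "?L \<noteq> {}" using assms unfolding girth_def by (auto simp: Inf_enat_def split: if_splits)
  then obtain x where "x \<in> ?L" by blast
  then have "Inf ?L \<in> ?L" by (rule wellorder_InfI)
  then show "\<exists>c. is_cycle E c \<and> length c = g" using assms unfolding girth_def by auto
qed

lemma gdist_le_eccentricity: "finite V \<Longrightarrow> v \<in> V \<Longrightarrow> gdist E u v \<le> eccentricity V E u"
  unfolding eccentricity_def by (intro Max_ge) auto

lemma eccentricity_attained: "finite V \<Longrightarrow> V \<noteq> {} \<Longrightarrow> \<exists>v\<in>V. gdist E u v = eccentricity V E u"
  unfolding eccentricity_def using Max_in[of "gdist E u ` V"]
  by (metis finite_imageI image_is_empty imageE)

text \<open>As \<open>d\<^sub>B < d\<^sub>A\<close> and \<open>d\<^sub>A\<close> is at most the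
  diameter, a vertex attaining the diameter lies in \<open>A\<close>. Thus
  \<open>d\<^sub>A = 2 r + 2\<close>, and eccentricities on \<open>B\<close> are at most
  \<open>2 r + 1\<close>. A vertex at distance \<open>2 r + 2\<close> from it lies in
  \<open>A\<close> by parity.\<close>

lemma girth_deficiency_two_intro:
  assumes dbr: "distance_biregular V E A B"
    and eccA: "\<forall>u\<in>A. eccentricity V E u = d\<^sub>A" and eccB: "\<forall>u\<in>B. eccentricity V E u = d\<^sub>B"
    and d: "d\<^sub>A > d\<^sub>B" "diameter V E = 2 * r + 2" "r \<ge> 1"
    and girth: "girth E = enat (2 * diameter V E - 2)"
    and degA: "\<forall>v\<in>A. degree_of E v = k + 1" and degB: "\<forall>v\<in>B. degree_of E v = l + 1"
  shows "girth_deficiency_two V E A B k l r"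
proof -
  interpret bipartite_graph V E A B
    using dbr by unfold_locales (simp_all add: distance_biregular_def)
  have V: "V \<noteq> {}" using connected unfolding connected_graph_def by blast
  have g: "girth E = enat (4 * r + 2)" using girth d(2) by simp
  obtain c where c: "is_cycle E c" "length c = 4 * r + 2" using girth_finiteD(2)[OF g] by blast
  \<comment> \<open>An edge of the cycle shows that \<open>A\<close> is nonempty, which ties
    \<open>d\<^sub>A\<close> to an actual eccentricity.\<close>
  have "0 < length c" using c(2) by simp
  then have "{c ! 0, c ! (Suc 0 mod length c)} \<in> E" using c(1) unfolding is_cycle_def by blast
  then obtain a\<^sub>0 where a0: "a\<^sub>0 \<in> A" by (rule edge_cases)
  have "eccentricity V E ` V \<noteq> {}" "finite (eccentricity V E ` V)" using V finite_V by simp_all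
  then have "diameter V E \<in> eccentricity V E ` V" unfolding diameter_def by (metis Max_in)
  then obtain v where v: "v \<in> V" "eccentricity V E v = 2 * r + 2" using d(2) by (metis imageE)
  have "d\<^sub>A \<le> diameter V E"
    using a0 AB(1) eccA finite_V unfolding diameter_def by (intro Max_ge) auto
  then have "v \<notin> B" using v(2) eccB d(1,2) by auto
  then have vA: "v \<in> A" using v(1) AB(1) by blast
  then have dA: "d\<^sub>A = 2 * r + 2" using eccA v(2) by simp
  obtain v' where v': "v' \<in> V" "gdist E v v' = 2 * r + 2"
    using eccentricity_attained[OF finite_V V, of E v] v(2) by auto
  have "v' \<in> A" using gdist_parity[OF v(1) v'(1)] v'(2) vA by simp
  show ?thesis
  proof unfold_locales
    show "degree_of E a = Suc k" if "a \<in> A" for a using degA that by simp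
    show "degree_of E b = Suc l" if "b \<in> B" for b using degB that by simp
    show "gdist E b w \<le> 2 * r + 1" if "b \<in> B" "w \<in> V" for b w
      using gdist_le_eccentricity[OF finite_V that(2), of E b] eccB that(1) d(1) dA by simp
    show "\<exists>a\<in>A. \<exists>a'\<in>A. gdist E a a' = 2 * r + 2" using vA \<open>v' \<in> A\<close> v'(2) by blast
    show "4 * r + 2 \<le> length c" if "is_cycle E c" for c using girth_finiteD(1)[OF g that] .
    show "\<exists>c. is_cycle E c \<and> length c = 4 * r + 2" using c by blast
    show "r \<ge> 1" by (rule d(3))
  qed
qed

text \<open>A representation is determined on the algebra by its values on \<open>M\<close> and
  \<open>N\<close>, so these values identify the models. Together with \<open>card R = r\<close>,
  the non-isomorphisms give the count \<open>r + 3\<close>.\<close>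

theorem theorem4p14:
  fixes V :: "'v set" and E :: "'v set set" and A B :: "'v set"
    and k l r d\<^sub>A d\<^sub>B :: nat and z :: "complex \<Rightarrow> complex"
  defines "\<A> \<equiv> adjacency_algebra E A B"
    and "M \<equiv> share_matrix E A"
    and "N \<equiv> share_matrix E B"
    and "R \<equiv> F_roots k l r"
  assumes "distance_biregular V E A B"
    and "\<forall>u\<in>A. eccentricity V E u = d\<^sub>A"
    and "\<forall>u\<in>B. eccentricity V E u = d\<^sub>B"
    and "d\<^sub>A > d\<^sub>B"
    and "diameter V E = 2 * r + 2" and "r \<ge> 1"
    and "girth E = enat (2 * diameter V E - 2)"
    and "\<forall>v\<in>A. degree_of E v = k + 1"
    and "\<forall>v\<in>B. degree_of E v = l + 1"
    and "\<forall>t\<in>R. (z t)\<^sup>2 = (1 + of_nat k * of_nat l - t) * (t + of_nat k + of_nat l) / (of_nat k + 1)\<^sup>2"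
  shows "card R = r \<and>
    (\<exists>(\<rho>\<^sub>1 :: 'v set cmat \<Rightarrow> complex \<Rightarrow> complex) (\<rho>\<^sub>2 :: 'v set cmat \<Rightarrow> complex \<Rightarrow> complex)
      (\<rho>\<^sub>3 :: 'v set cmat \<Rightarrow> complex \<Rightarrow> complex)
      (\<sigma> :: complex \<Rightarrow> 'v set cmat \<Rightarrow> complex^2 \<Rightarrow> complex^2).
      irreducible_rep E \<A> (*) \<rho>\<^sub>1 \<and> \<rho>\<^sub>1 M = (\<lambda>u. of_nat k * u) \<and> \<rho>\<^sub>1 N = (\<lambda>u. of_nat l * u) \<and>
      irreducible_rep E \<A> (*) \<rho>\<^sub>2 \<and> \<rho>\<^sub>2 M = (\<lambda>u. - 1 * u) \<and> \<rho>\<^sub>2 N = (\<lambda>u. - 1 * u) \<and>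
      irreducible_rep E \<A> (*) \<rho>\<^sub>3 \<and> \<rho>\<^sub>3 M = (\<lambda>u. of_nat k * u) \<and> \<rho>\<^sub>3 N = (\<lambda>u. - 1 * u) \<and>
      (\<forall>t\<in>R. irreducible_rep E \<A> (*s) (\<sigma> t) \<and>
         \<sigma> t M = (*v) (rho2_M k) \<and> \<sigma> t N = (*v) (rho2_N k l t (z t))) \<and>
      \<not> isomorphic_reps \<A> (*) \<rho>\<^sub>1 (*) \<rho>\<^sub>2 \<and>
      \<not> isomorphic_reps \<A> (*) \<rho>\<^sub>1 (*) \<rho>\<^sub>3 \<and>
      \<not> isomorphic_reps \<A> (*) \<rho>\<^sub>2 (*) \<rho>\<^sub>3 \<and>
      (\<forall>t\<in>R. \<forall>\<rho>\<in>{\<rho>\<^sub>1, \<rho>\<^sub>2, \<rho>\<^sub>3}. \<not> isomorphic_reps \<A> (*) \<rho> (*s) (\<sigma> t)) \<and>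
      (\<forall>t\<in>R. \<forall>t'\<in>R. t \<noteq> t' \<longrightarrow> \<not> isomorphic_reps \<A> (*s) (\<sigma> t) (*s) (\<sigma> t')) \<and>
      (\<forall>(s :: complex \<Rightarrow> 'u \<Rightarrow> 'u::ab_group_add) \<rho>.
         irreducible_rep E \<A> s \<rho> \<and> finite_dim s \<longrightarrow>
         (\<exists>\<rho>'\<in>{\<rho>\<^sub>1, \<rho>\<^sub>2, \<rho>\<^sub>3}. isomorphic_reps \<A> s \<rho> (*) \<rho>') \<or>
         (\<exists>t\<in>R. isomorphic_reps \<A> s \<rho> (*s) (\<sigma> t))))"
proof -
  interpret G: girth_deficiency_two V E A B k l r
    using assms(5-13) by (rule girth_deficiency_two_intro)
  have card: "card R = r"
    unfolding R_def using G.k_pos G.l_pos by (intro card_F_roots) simp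
  have k1: "of_nat k \<noteq> (- 1 :: complex)" and l1: "of_nat l \<noteq> (- 1 :: complex)"
    using of_nat_plus_1_nonzero[of k] of_nat_plus_1_nonzero[of l] by (metis add.left_inverse)+
  have M: "M \<in> \<A>" and N: "N \<in> \<A>"
    unfolding M_def N_def \<A>_def by (rule G.M_in, rule G.N_in)
  have repI: "representation E \<A> s \<rho>" if "irreducible_rep E \<A> s \<rho>" for s :: "complex \<Rightarrow> 'w \<Rightarrow> 'w::ab_group_add" and \<rho>
    using that unfolding irreducible_rep_def by (elim conjE)
  obtain \<rho>\<^sub>1 :: "'v set cmat \<Rightarrow> complex \<Rightarrow> complex" where
    \<rho>1: "irreducible_rep E \<A> (*) \<rho>\<^sub>1" "\<rho>\<^sub>1 M = (\<lambda>u. of_nat k * u)" "\<rho>\<^sub>1 N = (\<lambda>u. of_nat l * u)"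
    using G.exists_U11 unfolding \<A>_def[symmetric] M_def[symmetric] N_def[symmetric]
    by (elim exE conjE) (rule that)
  obtain \<rho>\<^sub>2 :: "'v set cmat \<Rightarrow> complex \<Rightarrow> complex" where
    \<rho>2: "irreducible_rep E \<A> (*) \<rho>\<^sub>2" "\<rho>\<^sub>2 M = (\<lambda>u. - 1 * u)" "\<rho>\<^sub>2 N = (\<lambda>u. - 1 * u)"
    using G.exists_U12 unfolding \<A>_def[symmetric] M_def[symmetric] N_def[symmetric]
    by (elim exE conjE) (rule that)
  obtain \<rho>\<^sub>3 :: "'v set cmat \<Rightarrow> complex \<Rightarrow> complex" where
    \<rho>3: "irreducible_rep E \<A> (*) \<rho>\<^sub>3" "\<rho>\<^sub>3 M = (\<lambda>u. of_nat k * u)" "\<rho>\<^sub>3 N = (\<lambda>u. - 1 * u)"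
    using G.exists_U13 unfolding \<A>_def[symmetric] M_def[symmetric] N_def[symmetric]
    by (elim exE conjE) (rule that)
  have "\<forall>t\<in>R. \<exists>\<sigma> :: 'v set cmat \<Rightarrow> complex^2 \<Rightarrow> complex^2. irreducible_rep E \<A> (*s) \<sigma> \<and>
      \<sigma> M = (*v) (rho2_M k) \<and> \<sigma> N = (*v) (rho2_N k l t (z t))"
    using G.exists_U_t assms(14) unfolding \<A>_def M_def N_def R_def by (intro ballI) simp
  then obtain \<sigma> :: "complex \<Rightarrow> 'v set cmat \<Rightarrow> complex^2 \<Rightarrow> complex^2" where
    \<sigma>: "\<forall>t\<in>R. irreducible_rep E \<A> (*s) (\<sigma> t) \<and>
      \<sigma> t M = (*v) (rho2_M k) \<and> \<sigma> t N = (*v) (rho2_N k l t (z t))"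
    by (rule bchoice[THEN exE])
  \<comment> \<open>\<open>M\<close> separates U_{1,2} from the other two 1-dimensional
    representations and \<open>N\<close> separates U_{1,1} from U_{1,3}, because \<open>k\<close>
    and \<open>l\<close> differ from \<open>-1\<close>.\<close>
  have n12: "\<not> isomorphic_reps \<A> (*) \<rho>\<^sub>1 (*) \<rho>\<^sub>2"
    by (rule not_isomorphic_one_dim[where a = M and \<rho> = \<rho>\<^sub>1 and \<rho>' = \<rho>\<^sub>2, OF M \<rho>1(2) \<rho>2(2) k1])
  have n13: "\<not> isomorphic_reps \<A> (*) \<rho>\<^sub>1 (*) \<rho>\<^sub>3"
    by (rule not_isomorphic_one_dim[where a = N and \<rho> = \<rho>\<^sub>1 and \<rho>' = \<rho>\<^sub>3, OF N \<rho>1(3) \<rho>3(3) l1])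
  have n23: "\<not> isomorphic_reps \<A> (*) \<rho>\<^sub>2 (*) \<rho>\<^sub>3"
    by (rule not_isomorphic_one_dim[where a = M and \<rho> = \<rho>\<^sub>2 and \<rho>' = \<rho>\<^sub>3, OF M \<rho>2(2) \<rho>3(2) k1[symmetric]])
  have n1t: "\<forall>t\<in>R. \<forall>\<rho>\<in>{\<rho>\<^sub>1, \<rho>\<^sub>2, \<rho>\<^sub>3}. \<not> isomorphic_reps \<A> (*) \<rho> (*s) (\<sigma> t)"
  proof (intro ballI)
    fix t \<rho> assume t: "t \<in> R" and "\<rho> \<in> {\<rho>\<^sub>1, \<rho>\<^sub>2, \<rho>\<^sub>3}"
    then obtain \<mu> where "\<rho> M = (\<lambda>u. \<mu> * u)" using \<rho>1(2) \<rho>2(2) \<rho>3(2) by blast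
    with \<sigma> t show "\<not> isomorphic_reps \<A> (*) \<rho> (*s) (\<sigma> t)"
      by (intro not_isomorphic_one_two_dim[where M = M and \<rho> = \<rho> and \<sigma> = "\<sigma> t", OF M]) blast+
  qed
  have ntt: "\<forall>t\<in>R. \<forall>t'\<in>R. t \<noteq> t' \<longrightarrow> \<not> isomorphic_reps \<A> (*s) (\<sigma> t) (*s) (\<sigma> t')"
  proof (intro ballI impI)
    fix t t' assume t: "t \<in> R" "t' \<in> R" "t \<noteq> t'"
    note \<sigma>t = \<sigma>[rule_format, OF t(1)] \<sigma>[rule_format, OF t(2)]
    show "\<not> isomorphic_reps \<A> (*s) (\<sigma> t) (*s) (\<sigma> t')"
      by (rule not_isomorphic_two_dim[where M = M and N = N and \<sigma> = "\<sigma> t" and \<sigma>' = "\<sigma> t'", OF M N _ _ _ _ t(3)])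
        (use \<sigma>t in blast)+
  qed
  have all: "\<forall>(s :: complex \<Rightarrow> 'u \<Rightarrow> 'u::ab_group_add) \<rho>.
     irreducible_rep E \<A> s \<rho> \<and> finite_dim s \<longrightarrow>
     (\<exists>\<rho>'\<in>{\<rho>\<^sub>1, \<rho>\<^sub>2, \<rho>\<^sub>3}. isomorphic_reps \<A> s \<rho> (*) \<rho>') \<or>
     (\<exists>t\<in>R. isomorphic_reps \<A> s \<rho> (*s) (\<sigma> t))"
  proof (intro allI impI)
    fix s :: "complex \<Rightarrow> 'u \<Rightarrow> 'u" and \<rho>
    assume "irreducible_rep E \<A> s \<rho> \<and> finite_dim s"
    then have irr: "irreducible_rep E \<A> s \<rho>" by (rule conjunct1)
    show "(\<exists>\<rho>'\<in>{\<rho>\<^sub>1, \<rho>\<^sub>2, \<rho>\<^sub>3}. isomorphic_reps \<A> s \<rho> (*) \<rho>') \<or>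
     (\<exists>t\<in>R. isomorphic_reps \<A> s \<rho> (*s) (\<sigma> t))"
      unfolding R_def \<A>_def
    proof (rule G.irreducible_rep_classification[where z = z and \<rho>\<^sub>1 = \<rho>\<^sub>1 and \<rho>\<^sub>2 = \<rho>\<^sub>2 and \<rho>\<^sub>3 = \<rho>\<^sub>3 and \<sigma> = \<sigma> and \<rho> = \<rho>])
      show "irreducible_rep E (adjacency_algebra E A B) s \<rho>" using irr unfolding \<A>_def .
    qed (use assms(14) \<sigma> repI[OF \<rho>1(1)] repI[OF \<rho>2(1)] repI[OF \<rho>3(1)] \<rho>1(2,3) \<rho>2(2,3) \<rho>3(2,3) repI
        in \<open>unfold M_def N_def \<A>_def R_def, blast\<close>)+
  qed
  show ?thesis
    by (rule conjI[OF card], rule exI[of _ \<rho>\<^sub>1], rule exI[of _ \<rho>\<^sub>2], rule exI[of _ \<rho>\<^sub>3], rule exI[of _ \<sigma>])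
      (intro conjI \<rho>1 \<rho>2 \<rho>3 \<sigma> n12 n13 n23 n1t ntt all)
qed

end
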